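(* Let $\mathcal Z=\{z\in\Omega: z_1=\cdots=z_d=0\}$, let $k\ge 1$, and let $\mathcal M_q=\mathcal M\ominus\mathcal M_0$ be the quotient module of the reproducing kernel Hilbert module $\mathcal M$ over $\mathcal A(\Omega)$ by the submodule $\mathcal M_0$ of functions in $\mathcal M$ vanishing to order at least $k$ along $\mathcal Z$. Then $\mathcal M_q$ is equivalent (unitarily isomorphic as a Hilbert module over $\mathcal A(\Omega)$) to the module $J(\mathcal M)|_{\mathcal Z}$ of $k$-jets restricted to $\mathcal Z$.
   Context: $\Omega\subset\mathbb C^m$ is a bounded domain containing the origin and $1\le d\le m$. $\mathcal A(\Omega)$ is the closure, in the supremum norm on $\overline\Omega$, of the functions holomorphic in a neighbourhood of $\overline\Omega$. A Hilbert module over $\mathcal A(\Omega)$ is a Hilbert space with a norm-continuous module action of $\mathcal A(\Omega)$; two Hilbert modules are isomorphic (equivalent, unitarily equivalent) if there is a unitary between them intertwining the actions. $\mathcal M$ is a Hilbert space of holomorphic functions $h=(h_1,\dots,h_r)^{tr}:\Omega\to\mathbb C^r$ which is a Hilbert module over $\mathcal A(\Omega)$ under pointwise multiplication, such that: every evaluation $ev_z:\mathcal M\to\mathbb C^r$, $z\in\Omega$, is bounded and surjective; the Gleason property holds (for $z\in\Omega$ and $h\in\mathcal M$, $h(z)=0$ iff $h(w)=\sum_{i=1}^m(w_i-z_i)h^{(i)}(w)$ for some $h^{(1)},\dots,h^{(m)}\in\mathcal M$); and $\mathcal M$ contains all $\mathbb C^r$-valued polynomials. $K$ denotes its ($M_r(\mathbb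 C)$-valued) reproducing kernel. For $\alpha\in(\mathbb N\cup\{0\})^d$, $\partial^\alpha=\partial_1^{\alpha_1}\cdots\partial_d^{\alpha_d}$ (only the first $d$ variables), $|\alpha|=\sum\alpha_i$, and $A=\{\alpha\in(\mathbb N\cup\{0\})^d:|\alpha|<k\}$, ordered colexicographically. $\mathcal M_0=\{h\in\mathcal M:\partial^\alpha h_j|_{\mathcal Z}=0,\ \alpha\in A,\ 1\le j\le r\}$. The quotient module is $\mathcal M_q=\mathcal M\ominus\mathcal M_0$ with action $f\cdot P(h)=P(fh)$, $P$ the orthogonal projection onto $\mathcal M_q$. Let $\{\varepsilon_\alpha\}_{\alpha\in A}$ and $\{\sigma_i\}_{i=1}^r$ be the standard bases of $\mathbb C^{|A|}$ and $\mathbb C^r$. For $h\in\mathcal M$ put $J(h)=\sum_{i=1}^r\big(\sum_{\alpha\in A}\partial^\alpha h_i\otimes\varepsilon_\alpha\big)\otimes\sigma_i$, and $J(\mathcal M)=\{J(h):h\in\mathcal M\}$ with the inner product making the injective map $J$ unitary. $\mathcal A(\Omega)$ acts on $J(\mathcal M)$ by $\mathbf h\mapsto(\mathcal J(f)\otimes I_r)\mathbf h$, where $\mathcal J(f)_{\alpha\beta}=\binom{\alpha}{\beta}\partial^{\alpha-\beta}f$ if $\beta\le\alpha$ componentwise and $0$ otherwise. $J(\mathcal M)|_{\mathcal Z}=\{\mathbf h|_{\mathcal Z}:\mathbf h\in J(\mathcal M)\}$ carries the quotient norm $\|\mathbf g\|=\inf\{\|\mathbf h\|:\mathbf h\in J(\mathcal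 M),\ \mathbf h|_{\mathcal Z}=\mathbf g\}$ (equivalently, it is the Hilbert space with reproducing kernel the restriction to $\mathcal Z$ of the kernel $JK(z,w)=\big(\partial^\alpha\bar\partial^\beta K_{ij}(z,w)\big)$ of $J(\mathcal M)$), with the module action $f\cdot\mathbf h|_{\mathcal Z}=(\mathcal J(f)\otimes I_r)|_{\mathcal Z}\,\mathbf h|_{\mathcal Z}$. *)

theory Defs
  imports "HOL-Analysis.Analysis" "HOL-Algebra.Module" "HOL-Library.FuncSet"
begin

text \<open>A function on a set \<open>S\<close> is represented by the total function that is \<open>undefined\<close> off \<open>S\<close>,
  i.e. by an element of \<open>extensional S\<close>.  The coordinates of \<open>\<complex>\<^sup>m\<close> are indexed by a
  finite linearly ordered type with \<open>m\<close> elements, so that ``the first \<open>d\<close> variables'' makes sense.\<close>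

type_synonym 'm cvec = "(complex, 'm) vec"


section \<open>Hilbert spaces\<close>

definition complex_ring :: "complex ring" where
  "complex_ring = \<lparr>carrier = UNIV, mult = (*), one = 1, zero = 0, add = (+)\<rparr>"

text \<open>In the next record \<open>smult\<close> is the multiplication by complex scalars, \<open>ip\<close> the inner
  product (linear in the first argument) and \<open>act\<close> the action of the function algebra.  The fields
  \<open>mult\<close> and \<open>one\<close>, inherited from the library's record of modules, play no role and are left
  \<open>undefined\<close>.\<close>

record ('f, 'v) hilb = "(complex, 'v) module" +
  ip :: "'v \<Rightarrow> 'v \<Rightarrow> complex"
  act :: "'f \<Rightarrow> 'v \<Rightarrow> 'v"

definition hnorm :: "('f, 'v) hilb \<Rightarrow> 'v \<Rightarrow> real" where
  "hnorm H x = sqrt (Re (ip H x x))"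

definition inner_product_space :: "('f, 'v) hilb \<Rightarrow> bool" where
  "inner_product_space H \<longleftrightarrow>
     module complex_ring H \<and>
     (\<forall>x\<in>carrier H. \<forall>y\<in>carrier H. ip H y x = cnj (ip H x y)) \<and>
     (\<forall>x\<in>carrier H. \<forall>y\<in>carrier H. \<forall>z\<in>carrier H.
        ip H (x \<oplus>\<^bsub>H\<^esub> y) z = ip H x z + ip H y z) \<and>
     (\<forall>c. \<forall>x\<in>carrier H. \<forall>y\<in>carrier H. ip H (c \<odot>\<^bsub>H\<^esub> x) y = c * ip H x y) \<and>
     (\<forall>x\<in>carrier H. 0 \<le> Re (ip H x x)) \<and>
     (\<forall>x\<in>carrier H. ip H x x = 0 \<longrightarrow> x = \<zero>\<^bsub>H\<^esub>)"

definition hilbert_space :: "('f, 'v) hilb \<Rightarrow> bool" where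
  "hilbert_space H \<longleftrightarrow>
     inner_product_space H \<and>
     (\<forall>X::nat \<Rightarrow> 'v. range X \<subseteq> carrier H \<longrightarrow>
        (\<forall>e>0. \<exists>N. \<forall>m\<ge>N. \<forall>n\<ge>N. hnorm H (X m \<ominus>\<^bsub>H\<^esub> X n) < e) \<longrightarrow>
        (\<exists>x\<in>carrier H. \<forall>e>0. \<exists>N. \<forall>n\<ge>N. hnorm H (X n \<ominus>\<^bsub>H\<^esub> x) < e))"

definition orth_complement :: "('f, 'v) hilb \<Rightarrow> 'v set \<Rightarrow> 'v set" where
  "orth_complement H S = {x \<in> carrier H. \<forall>y\<in>S. ip H x y = 0}"

definition orth_proj :: "('f, 'v) hilb \<Rightarrow> 'v set \<Rightarrow> 'v \<Rightarrow> 'v" where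
  "orth_proj H S x = (THE y. y \<in> S \<and> (\<forall>s\<in>S. ip H (x \<ominus>\<^bsub>H\<^esub> y) s = 0))"


section \<open>Holomorphic functions of several variables\<close>

definition holomorphic_several :: "('m::finite cvec \<Rightarrow> complex) \<Rightarrow> 'm::finite cvec set \<Rightarrow> bool" where
  "holomorphic_several f U \<longleftrightarrow>
     (\<forall>z\<in>U. \<exists>D. (f has_derivative D) (at z) \<and> (\<forall>c v. D (c *s v) = c * D v))"

text \<open>\<open>\<A>(\<Omega>)\<close>, with functions living on the closure of \<open>\<Omega>\<close>.\<close>

definition algebra_A :: "'m::finite cvec set \<Rightarrow> ('m::finite cvec \<Rightarrow> complex) set" where
  "algebra_A \<Omega> = {f \<in> extensional (closure \<Omega>).
     \<forall>e>0. \<exists>g U. open U \<and> closure \<Omega> \<subseteq> U \<and> holomorphic_several g U \<and>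
       (\<forall>z\<in>closure \<Omega>. cmod (f z - g z) < e)}"

definition ring_A :: "'m::finite cvec set \<Rightarrow> ('m::finite cvec \<Rightarrow> complex) ring" where
  "ring_A \<Omega> = \<lparr>carrier = algebra_A \<Omega>,
     mult = (\<lambda>f g. \<lambda>z\<in>closure \<Omega>. f z * g z), one = (\<lambda>z\<in>closure \<Omega>. 1),
     zero = (\<lambda>z\<in>closure \<Omega>. 0), add = (\<lambda>f g. \<lambda>z\<in>closure \<Omega>. f z + g z)\<rparr>"

definition sup_dist ::
  "'m::finite cvec set \<Rightarrow> ('m::finite cvec \<Rightarrow> complex) \<Rightarrow> ('m::finite cvec \<Rightarrow> complex) \<Rightarrow> real" where
  "sup_dist \<Omega> f g = (SUP z\<in>closure \<Omega>. cmod (f z - g z))"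


section \<open>Hilbert modules over the function algebra\<close>

text \<open>The condition on constant functions makes the two scalar multiplications agree; the last
  condition is joint continuity of the action in the two norms.\<close>

definition hilbert_module ::
  "'m::finite cvec set \<Rightarrow> ('m::finite cvec \<Rightarrow> complex, 'v) hilb \<Rightarrow> bool" where
  "hilbert_module \<Omega> H \<longleftrightarrow>
     hilbert_space H \<and>
     module (ring_A \<Omega>)
       \<lparr>carrier = carrier H, mult = mult H, one = one H, zero = zero H, add = add H,
        smult = act H\<rparr> \<and>
     (\<forall>c. \<forall>x\<in>carrier H. act H (\<lambda>z\<in>closure \<Omega>. c) x = c \<odot>\<^bsub>H\<^esub> x) \<and>
     (\<forall>f\<in>algebra_A \<Omega>. \<forall>x\<in>carrier H. \<forall>e>0. \<exists>\<delta>>0.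
        \<forall>g\<in>algebra_A \<Omega>. \<forall>y\<in>carrier H.
          sup_dist \<Omega> g f < \<delta> \<longrightarrow> hnorm H (y \<ominus>\<^bsub>H\<^esub> x) < \<delta> \<longrightarrow>
          hnorm H (act H g y \<ominus>\<^bsub>H\<^esub> act H f x) < e)"

definition unitary_between :: "('f, 'v) hilb \<Rightarrow> ('f, 'w) hilb \<Rightarrow> ('v \<Rightarrow> 'w) \<Rightarrow> bool" where
  "unitary_between H1 H2 U \<longleftrightarrow>
     bij_betw U (carrier H1) (carrier H2) \<and>
     (\<forall>x\<in>carrier H1. \<forall>y\<in>carrier H1. U (x \<oplus>\<^bsub>H1\<^esub> y) = U x \<oplus>\<^bsub>H2\<^esub> U y) \<and>
     (\<forall>c. \<forall>x\<in>carrier H1. U (c \<odot>\<^bsub>H1\<^esub> x) = c \<odot>\<^bsub>H2\<^esub> U x) \<and>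
     (\<forall>x\<in>carrier H1. \<forall>y\<in>carrier H1. ip H2 (U x) (U y) = ip H1 x y)"

definition hilbert_modules_equivalent ::
  "'m::finite cvec set \<Rightarrow> ('m::finite cvec \<Rightarrow> complex, 'v) hilb \<Rightarrow>
   ('m::finite cvec \<Rightarrow> complex, 'w) hilb \<Rightarrow> bool" where
  "hilbert_modules_equivalent \<Omega> H1 H2 \<longleftrightarrow>
     hilbert_module \<Omega> H1 \<and> hilbert_module \<Omega> H2 \<and>
     (\<exists>U. unitary_between H1 H2 U \<and>
        (\<forall>f\<in>algebra_A \<Omega>. \<forall>x\<in>carrier H1. U (act H1 f x) = act H2 f (U x)))"

definition quotient_module :: "('f, 'v) hilb \<Rightarrow> 'v set \<Rightarrow> ('f, 'v) hilb" where
  "quotient_module H S =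
     H\<lparr>carrier := orth_complement H S,
       act := (\<lambda>f x. orth_proj H (orth_complement H S) (act H f x))\<rparr>"


section \<open>The reproducing kernel Hilbert module\<close>

text \<open>The structure, with pointwise operations, on a set \<open>V\<close> of functions \<open>\<Omega> \<rightarrow> \<complex>\<^sup>r\<close> with inner
  product \<open>p\<close>.\<close>

definition function_module ::
  "'m::finite cvec set \<Rightarrow> ('m::finite cvec \<Rightarrow> complex ^ 'r) set \<Rightarrow>
   (('m::finite cvec \<Rightarrow> complex ^ 'r) \<Rightarrow> ('m::finite cvec \<Rightarrow> complex ^ 'r) \<Rightarrow> complex) \<Rightarrow>
   ('m::finite cvec \<Rightarrow> complex, 'm::finite cvec \<Rightarrow> complex ^ 'r) hilb" where
  "function_module \<Omega> V p = \<lparr>carrier = V, mult = undefined, one = undefined,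
     zero = (\<lambda>z\<in>\<Omega>. 0), add = (\<lambda>g h. \<lambda>z\<in>\<Omega>. g z + h z),
     smult = (\<lambda>c h. \<lambda>z\<in>\<Omega>. c *s h z), ip = p,
     act = (\<lambda>f h. \<lambda>z\<in>\<Omega>. f z *s h z)\<rparr>"

definition vector_polynomial :: "('m::finite cvec \<Rightarrow> complex ^ 'r) \<Rightarrow> bool" where
  "vector_polynomial q \<longleftrightarrow>
     (\<exists>S c. finite S \<and>
        q = (\<lambda>z. \<Sum>\<gamma>\<in>S. (\<Prod>i\<in>UNIV. (z $ i) ^ (\<gamma> :: 'm \<Rightarrow> nat) i) *s c \<gamma>))"

definition rk_hilbert_module ::
  "'m::finite cvec set \<Rightarrow>
   ('m::finite cvec \<Rightarrow> complex, 'm::finite cvec \<Rightarrow> complex ^ 'r) hilb \<Rightarrow> bool" where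
  "rk_hilbert_module \<Omega> M \<longleftrightarrow>
     (\<exists>V p. M = function_module \<Omega> V p) \<and>
     hilbert_module \<Omega> M \<and>
     (\<forall>h\<in>carrier M. h \<in> extensional \<Omega> \<and> (\<forall>j. holomorphic_several (\<lambda>z. h z $ j) \<Omega>)) \<and>
     (\<forall>z\<in>\<Omega>. \<exists>C. \<forall>h\<in>carrier M. norm (h z) \<le> C * hnorm M h) \<and>
     (\<forall>z\<in>\<Omega>. (\<lambda>h. h z) ` carrier M = UNIV) \<and>
     (\<forall>z\<in>\<Omega>. \<forall>h\<in>carrier M. h z = 0 \<longleftrightarrow>
        (\<exists>g :: 'm \<Rightarrow> 'm::finite cvec \<Rightarrow> complex ^ 'r. (\<forall>i. g i \<in> carrier M) \<and>
           (\<forall>w\<in>\<Omega>. h w = (\<Sum>i\<in>UNIV. (w $ i - z $ i) *s g i w)))) \<and>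
     (\<forall>q. vector_polynomial q \<longrightarrow> restrict q \<Omega> \<in> carrier M)"


section \<open>Vanishing along the linear subvariety\<close>

definition first_vars :: "nat \<Rightarrow> ('m::{finite,linorder}) set" where
  "first_vars d = {i. card {j. j < i} < d}"

definition zero_locus ::
  "nat \<Rightarrow> 'm::{finite,linorder} cvec set \<Rightarrow> 'm cvec set" where
  "zero_locus d \<Omega> = {z \<in> \<Omega>. \<forall>i\<in>first_vars d. z $ i = 0}"

text \<open>The set \<open>A\<close>; a multi-index in the first \<open>d\<close> variables is one in all \<open>m\<close> variables that
  vanishes on the remaining ones.\<close>

definition jet_indices :: "nat \<Rightarrow> nat \<Rightarrow> ('m::{finite,linorder} \<Rightarrow> nat) set" where
  "jet_indices d k = {\<alpha>. (\<forall>i. i \<notin> first_vars d \<longrightarrow> \<alpha> i = 0) \<and> (\<Sum>i\<in>UNIV. \<alpha> i) < k}"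

definition partial :: "'m \<Rightarrow> ('m::finite cvec \<Rightarrow> complex) \<Rightarrow> 'm cvec \<Rightarrow> complex" where
  "partial i f z = deriv (\<lambda>t. f (z + t *s axis i 1)) 0"

definition multi_partial ::
  "nat \<Rightarrow> ('m::{finite,linorder} \<Rightarrow> nat) \<Rightarrow>
   ('m cvec \<Rightarrow> complex) \<Rightarrow> 'm cvec \<Rightarrow> complex" where
  "multi_partial d \<alpha> f =
     foldr (\<lambda>i. partial i ^^ \<alpha> i) (sorted_list_of_set (first_vars d)) f"

definition vanishing_submodule ::
  "nat \<Rightarrow> nat \<Rightarrow> 'm::{finite,linorder} cvec set \<Rightarrow>
   ('m cvec \<Rightarrow> complex, 'm cvec \<Rightarrow> complex ^ 'r) hilb \<Rightarrow>
   ('m cvec \<Rightarrow> complex ^ 'r) set" where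
  "vanishing_submodule d k \<Omega> M = {h \<in> carrier M.
     \<forall>\<alpha>\<in>jet_indices d k. \<forall>j. \<forall>z\<in>zero_locus d \<Omega>. multi_partial d \<alpha> (\<lambda>w. h w $ j) z = 0}"


section \<open>Modules of jets\<close>

text \<open>A vector of \<open>\<complex>\<^bsup>|A|\<^esup> \<otimes> \<complex>\<^sup>r\<close> is given by its coordinates with respect to the basis
  \<open>\<epsilon>\<^sub>\<alpha> \<otimes> \<sigma>\<^sub>i\<close>, i.e. by a function on \<open>A \<times> {1,\<dots>,r}\<close>.  As coordinates and matrix entries are
  labelled by \<open>A\<close> itself, no enumeration of \<open>A\<close> has to be chosen.\<close>

type_synonym ('m, 'r) jet = "('m \<Rightarrow> nat) \<times> 'r \<Rightarrow> complex"

definition jet_map ::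
  "nat \<Rightarrow> nat \<Rightarrow> 'm::{finite,linorder} cvec set \<Rightarrow>
   ('m cvec \<Rightarrow> complex ^ 'r) \<Rightarrow> 'm cvec \<Rightarrow> ('m, 'r) jet" where
  "jet_map d k \<Omega> h = (\<lambda>z\<in>\<Omega>. \<lambda>(\<alpha>, i)\<in>jet_indices d k \<times> UNIV.
     multi_partial d \<alpha> (\<lambda>w. h w $ i) z)"

definition jet_matrix ::
  "nat \<Rightarrow> ('m::{finite,linorder} cvec \<Rightarrow> complex) \<Rightarrow> 'm cvec \<Rightarrow>
   ('m \<Rightarrow> nat) \<Rightarrow> ('m \<Rightarrow> nat) \<Rightarrow> complex" where
  "jet_matrix d f z \<alpha> \<beta> =
     (if \<beta> \<le> \<alpha> then of_nat (\<Prod>i\<in>UNIV. \<alpha> i choose \<beta> i) * multi_partial d (\<lambda>i. \<alpha> i - \<beta> i) f z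
      else 0)"

text \<open>Application of the Kronecker product \<open>\<J>(f)(z) \<otimes> I\<^sub>r\<close>.\<close>

definition jet_act ::
  "nat \<Rightarrow> nat \<Rightarrow> ('m::{finite,linorder} cvec \<Rightarrow> complex) \<Rightarrow> 'm cvec \<Rightarrow>
   ('m, 'r::finite) jet \<Rightarrow> ('m, 'r) jet" where
  "jet_act d k f z v = (\<lambda>(\<alpha>, i)\<in>jet_indices d k \<times> UNIV.
     \<Sum>(\<beta>, j)\<in>jet_indices d k \<times> UNIV.
       jet_matrix d f z \<alpha> \<beta> * (if i = j then 1 else 0) * v (\<beta>, j))"

text \<open>The structure on a set \<open>V\<close> of jet-valued functions on \<open>S\<close> with inner product \<open>p\<close>.\<close>

definition jet_function_module ::
  "nat \<Rightarrow> nat \<Rightarrow> 'm::{finite,linorder} cvec set \<Rightarrow>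
   ('m cvec \<Rightarrow> ('m, 'r::finite) jet) set \<Rightarrow>
   (('m cvec \<Rightarrow> ('m, 'r) jet) \<Rightarrow> ('m cvec \<Rightarrow> ('m, 'r) jet) \<Rightarrow> complex) \<Rightarrow>
   ('m cvec \<Rightarrow> complex, 'm cvec \<Rightarrow> ('m, 'r) jet) hilb" where
  "jet_function_module d k S V p = \<lparr>carrier = V, mult = undefined, one = undefined,
     zero = (\<lambda>z\<in>S. \<lambda>x\<in>jet_indices d k \<times> UNIV. 0),
     add = (\<lambda>u v. \<lambda>z\<in>S. \<lambda>x\<in>jet_indices d k \<times> UNIV. u z x + v z x),
     smult = (\<lambda>c u. \<lambda>z\<in>S. \<lambda>x\<in>jet_indices d k \<times> UNIV. c * u z x), ip = p,
     act = (\<lambda>f u. \<lambda>z\<in>S. jet_act d k f z (u z))\<rparr>"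

definition jet_module ::
  "nat \<Rightarrow> nat \<Rightarrow> 'm::{finite,linorder} cvec set \<Rightarrow>
   ('m cvec \<Rightarrow> complex, 'm cvec \<Rightarrow> complex ^ 'r) hilb \<Rightarrow>
   ('m cvec \<Rightarrow> complex, 'm cvec \<Rightarrow> ('m, 'r) jet) hilb" where
  "jet_module d k \<Omega> M =
     jet_function_module d k \<Omega> (jet_map d k \<Omega> ` carrier M)
       (\<lambda>u v. ip M (the_inv_into (carrier M) (jet_map d k \<Omega>) u)
                   (the_inv_into (carrier M) (jet_map d k \<Omega>) v))"

definition restricted_norm ::
  "('f, 'p \<Rightarrow> 'w) hilb \<Rightarrow> 'p set \<Rightarrow> ('p \<Rightarrow> 'w) \<Rightarrow> real" where
  "restricted_norm H S g = Inf {hnorm H u | u. u \<in> carrier H \<and> restrict u S = g}"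

text \<open>The inner product of the restriction is the one determined by the quotient norm through
  polarization.\<close>

definition jet_module_restricted ::
  "nat \<Rightarrow> nat \<Rightarrow> 'm::{finite,linorder} cvec set \<Rightarrow>
   ('m cvec \<Rightarrow> complex, 'm cvec \<Rightarrow> complex ^ 'r) hilb \<Rightarrow>
   ('m cvec \<Rightarrow> complex, 'm cvec \<Rightarrow> ('m, 'r) jet) hilb" where
  "jet_module_restricted d k \<Omega> M =
     jet_function_module d k (zero_locus d \<Omega>)
       ((\<lambda>u. restrict u (zero_locus d \<Omega>)) ` carrier (jet_module d k \<Omega> M))
       (\<lambda>u v. (\<Sum>n<4. \<i> ^ n * of_real
          ((restricted_norm (jet_module d k \<Omega> M) (zero_locus d \<Omega>)
             (\<lambda>z\<in>zero_locus d \<Omega>. \<lambda>x\<in>jet_indices d k \<times> UNIV. u z x + \<i> ^ n * v z x))\<^sup>2)) / 4)"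

end

theory Submission
  imports Defs "HOL-Complex_Analysis.Cauchy_Integral_Formula"
begin

text \<open>
  Write \<open>Z\<close> for the zero locus, \<open>M\<^sub>0\<close> for the submodule of functions vanishing along it, and \<open>R\<close>
  for the map sending \<open>h \<in> M\<close> to the restriction of its jet to \<open>Z\<close>.  The map \<open>R\<close> is linear with kernel
  \<open>M\<^sub>0\<close>, and the norm on its range is by definition the quotient norm of \<open>M / M\<^sub>0\<close>.  Hence \<open>R\<close>,
  restricted to the orthogonal complement of \<open>M\<^sub>0\<close>, should be the required unitary.  Three things
  have to be supplied.

  First, \<open>M\<^sub>0\<close> must be closed, since otherwise the infimum defining the quotient norm vanishes on
  nonzero jets.  Point evaluations are bounded by hypothesis; a derivative at a point is a pointwise
  limit of difference quotients of evaluations, and by the uniform boundedness principle a pointwise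
  limit of bounded functionals is bounded.  So all the functionals \<open>h \<mapsto> \<partial>\<^sup>\<alpha> h\<^sub>j(z)\<close> with \<open>z \<in> \<Omega>\<close> are
  bounded (\<open>bounded_functional_iterated_partial\<close>), and \<open>M\<^sub>0\<close> is an intersection of their kernels.  The
  projection theorem then splits off \<open>M\<^sub>0\<close>, the infimum in the quotient norm is attained at the
  orthogonal representative, and polarization turns equality of norms into equality of inner products
  (\<open>ip_JMZ\<close>).

  Second, \<open>R\<close> must intertwine the actions.  The Leibniz rule (\<open>Leibniz_iterated_partial\<close>) says exactly
  that the jet of \<open>f h\<close> is \<open>\<J>(f)\<close> applied to the jet of \<open>h\<close>.  It also shows that \<open>M\<^sub>0\<close> is invariant
  under the action, so that \<open>R\<close> does not see the projection in the quotient action: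
  \<open>R (P (f h)) = R (f h)\<close>.  The rule applies because \<open>f \<in> \<A>(\<Omega>)\<close> is holomorphic on \<open>\<Omega>\<close>:
  multiplying a constant polynomial by \<open>f\<close> stays inside \<open>M\<close> (\<open>holomorphic_algebra_A\<close>).

  Third, both sides must be Hilbert modules.  For the quotient this follows from the invariance and
  closedness of \<open>M\<^sub>0\<close> (\<open>hilbert_module_quotient\<close>), and the unitary \<open>R\<close> transports the structure to the
  module of restricted jets (\<open>hilbert_module_transport\<close>).
\<close>

section \<open>Hilbert spaces: projections and uniform boundedness\<close>

lemma complex_ring_simps [simp]:
  "carrier complex_ring = UNIV" "add complex_ring = (+)" "mult complex_ring = (*)"
  "one complex_ring = 1" "zero complex_ring = 0"
  by (simp_all add: complex_ring_def)

text \<open>The value of \<open>\<parallel>y - c t\<parallel>\<^sup>2\<close> at the minimizing scalar \<open>c = a / n\<close>, where \<open>u = \<parallel>y\<parallel>\<^sup>2\<close>,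
  \<open>a = \<langle>y, t\<rangle>\<close> and \<open>n = \<parallel>t\<parallel>\<^sup>2\<close>.  Both the Cauchy-Schwarz inequality and the orthogonality of the
  closest point are read off from it.\<close>

lemma complete_square:
  fixes a :: complex and u n :: real
  assumes "n > 0"
  shows "of_real u - cnj (a / of_real n) * a - (a / of_real n) * cnj a
      + (a / of_real n) * cnj (a / of_real n) * of_real n = of_real (u - (cmod a)\<^sup>2 / n)"
proof -
  have "of_real u - cnj (a / of_real n) * a - (a / of_real n) * cnj a
      + (a / of_real n) * cnj (a / of_real n) * of_real n = of_real u - (a * cnj a) / of_real n"
    using assms by (simp add: field_simps)
  then show ?thesis using complex_norm_square[of a] by simp
qed

locale ip_space =
  fixes H :: "('f, 'v) hilb" (structure)
  assumes ips: "inner_product_space H"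
begin

lemma module_H: "module complex_ring H"
  using ips by (simp add: inner_product_space_def)

sublocale module complex_ring H by (rule module_H)

lemma ip_sym: "x \<in> carrier H \<Longrightarrow> y \<in> carrier H \<Longrightarrow> ip H y x = cnj (ip H x y)"
  using ips unfolding inner_product_space_def by blast

lemma ip_add_left [simp]:
  "x \<in> carrier H \<Longrightarrow> y \<in> carrier H \<Longrightarrow> z \<in> carrier H \<Longrightarrow> ip H (x \<oplus> y) z = ip H x z + ip H y z"
  using ips unfolding inner_product_space_def by blast

lemma ip_smult_left [simp]:
  "x \<in> carrier H \<Longrightarrow> y \<in> carrier H \<Longrightarrow> ip H (c \<odot>\<^bsub>H\<^esub> x) y = c * ip H x y"
  using ips unfolding inner_product_space_def by blast

lemma ip_add_right [simp]:
  "x \<in> carrier H \<Longrightarrow> y \<in> carrier H \<Longrightarrow> z \<in> carrier H \<Longrightarrow> ip H z (x \<oplus> y) = ip H z x + ip H z y"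
  by (subst (1 2 3) ip_sym) simp_all

lemma ip_smult_right [simp]:
  "x \<in> carrier H \<Longrightarrow> y \<in> carrier H \<Longrightarrow> ip H y (c \<odot>\<^bsub>H\<^esub> x) = cnj c * ip H y x"
  by (subst (1 2) ip_sym) simp_all

lemma ip_zero_left [simp]: "x \<in> carrier H \<Longrightarrow> ip H \<zero> x = 0"
  using ip_add_left[of \<zero> \<zero> x] by simp

lemma ip_zero_right [simp]: "x \<in> carrier H \<Longrightarrow> ip H x \<zero> = 0"
  using ip_add_right[of \<zero> \<zero> x] by simp

lemma ip_neg_left: "x \<in> carrier H \<Longrightarrow> z \<in> carrier H \<Longrightarrow> ip H (\<ominus> x) z = - ip H x z"
  using ip_add_left[of "\<ominus> x" x z] by (simp add: l_neg add_eq_0_iff2)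

lemma ip_minus_left [simp]:
  "x \<in> carrier H \<Longrightarrow> y \<in> carrier H \<Longrightarrow> z \<in> carrier H \<Longrightarrow> ip H (x \<ominus> y) z = ip H x z - ip H y z"
  by (simp add: minus_eq ip_neg_left)

lemma ip_minus_right [simp]:
  "x \<in> carrier H \<Longrightarrow> y \<in> carrier H \<Longrightarrow> z \<in> carrier H \<Longrightarrow> ip H z (x \<ominus> y) = ip H z x - ip H z y"
  by (subst (1 2 3) ip_sym) simp_all

lemma Re_ip_self_nonneg: "x \<in> carrier H \<Longrightarrow> 0 \<le> Re (ip H x x)"
  using ips unfolding inner_product_space_def by blast

lemma hnorm_nonneg [simp]: "x \<in> carrier H \<Longrightarrow> 0 \<le> hnorm H x"
  by (simp add: hnorm_def Re_ip_self_nonneg)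

lemma hnorm_power2: "x \<in> carrier H \<Longrightarrow> (hnorm H x)\<^sup>2 = Re (ip H x x)"
  by (simp add: hnorm_def Re_ip_self_nonneg)

lemma ip_self: "x \<in> carrier H \<Longrightarrow> ip H x x = of_real ((hnorm H x)\<^sup>2)"
proof -
  assume x: "x \<in> carrier H"
  have "Im (ip H x x) = 0"
    using arg_cong[OF ip_sym[OF x x], of Im] by simp
  then show ?thesis using x by (simp add: hnorm_power2 complex_eq_iff)
qed

lemma ip_self_eq_0: "x \<in> carrier H \<Longrightarrow> ip H x x = 0 \<Longrightarrow> x = \<zero>"
  using ips unfolding inner_product_space_def by blast

lemma hnorm_eq_0: "x \<in> carrier H \<Longrightarrow> hnorm H x = 0 \<longleftrightarrow> x = \<zero>"
  by (metis hnorm_def hnorm_power2 ip_self ip_self_eq_0 ip_zero_left of_real_0 power_zero_numeral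
      real_sqrt_zero zero_complex.sel(1))

lemma hnorm_zero [simp]: "hnorm H \<zero> = 0"
  by (simp add: hnorm_eq_0)

text \<open>Testing against all vectors reduces identities in the module \<open>H\<close> to identities of complex
  numbers, which the simplifier decides.\<close>

lemma ip_eqI:
  assumes x: "x \<in> carrier H" and y: "y \<in> carrier H"
    and "\<And>z. z \<in> carrier H \<Longrightarrow> ip H x z = ip H y z"
  shows "x = y"
proof -
  have "ip H (x \<ominus> y) (x \<ominus> y) = 0"
    using assms by (subst ip_minus_left) simp_all
  then have "x \<ominus> y = \<zero>" by (rule ip_self_eq_0[rotated]) (simp add: x y)
  then have "x \<oplus> \<ominus> y = \<zero>" by (simp add: minus_eq)
  then show ?thesis using x y
    by (metis M.add.inv_closed M.minus_equality M.minus_minus)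
qed

lemma minus_self [simp]: "x \<in> carrier H \<Longrightarrow> x \<ominus> x = \<zero>"
  by (rule ip_eqI) simp_all

lemma minus_via_smult: "x \<in> carrier H \<Longrightarrow> y \<in> carrier H \<Longrightarrow> x \<ominus> y = x \<oplus> (-1) \<odot>\<^bsub>H\<^esub> y"
  by (rule ip_eqI) simp_all

lemma minus_eq_zero_iff: "x \<in> carrier H \<Longrightarrow> y \<in> carrier H \<Longrightarrow> x \<ominus> y = \<zero> \<longleftrightarrow> x = y"
  by (metis ip_eqI ip_minus_left ip_zero_left minus_self right_minus_eq)

lemma Cauchy_Schwarz:
  assumes x: "x \<in> carrier H" and y: "y \<in> carrier H"
  shows "cmod (ip H x y) \<le> hnorm H x * hnorm H y"
proof (cases "y = \<zero>")
  case True
  then show ?thesis using x by simp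
next
  case False
  define n where "n = (hnorm H y)\<^sup>2"
  have n: "n > 0" using False y hnorm_eq_0[OF y] by (simp add: n_def)
  define c where "c = ip H x y / of_real n"
  have "0 \<le> Re (ip H (x \<ominus> c \<odot>\<^bsub>H\<^esub> y) (x \<ominus> c \<odot>\<^bsub>H\<^esub> y))"
    by (rule Re_ip_self_nonneg) (simp add: x y)
  also have "ip H (x \<ominus> c \<odot>\<^bsub>H\<^esub> y) (x \<ominus> c \<odot>\<^bsub>H\<^esub> y)
      = ip H x x - cnj c * ip H x y - c * cnj (ip H x y) + c * cnj c * ip H y y"
    using x y ip_sym[OF x y] by (simp add: algebra_simps)
  also have "\<dots> = of_real ((hnorm H x)\<^sup>2 - (cmod (ip H x y))\<^sup>2 / n)"
    unfolding ip_self[OF x] ip_self[OF y] n_def[symmetric] c_def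
    by (rule complete_square[OF n])
  finally have "(cmod (ip H x y))\<^sup>2 \<le> (hnorm H x)\<^sup>2 * n"
    using n by (simp add: field_simps)
  then show ?thesis
    by (metis abs_le_square_iff abs_of_nonneg hnorm_nonneg mult_nonneg_nonneg n_def norm_ge_zero
        power_mult_distrib x y)
qed

lemma hnorm_triangle:
  assumes x: "x \<in> carrier H" and y: "y \<in> carrier H"
  shows "hnorm H (x \<oplus> y) \<le> hnorm H x + hnorm H y"
proof (rule power2_le_imp_le)
  have "Re (ip H x y) \<le> hnorm H x * hnorm H y"
    using Cauchy_Schwarz[OF x y] complex_Re_le_cmod order_trans by blast
  then show "(hnorm H (x \<oplus> y))\<^sup>2 \<le> (hnorm H x + hnorm H y)\<^sup>2"
    using x y ip_sym[OF x y] by (simp add: hnorm_power2 power2_sum)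
qed (simp add: x y)

lemma hnorm_smult: "x \<in> carrier H \<Longrightarrow> hnorm H (c \<odot>\<^bsub>H\<^esub> x) = cmod c * hnorm H x"
proof -
  assume x: "x \<in> carrier H"
  have "ip H (c \<odot>\<^bsub>H\<^esub> x) (c \<odot>\<^bsub>H\<^esub> x) = of_real ((cmod c * hnorm H x)\<^sup>2)"
    using x complex_norm_square[of c]
    by (simp add: ip_self[OF x] power_mult_distrib mult.commute mult.left_commute)
  then show ?thesis using x by (simp add: hnorm_def[of H "c \<odot>\<^bsub>H\<^esub> x"])
qed

lemma hnorm_minus_commute:
  "x \<in> carrier H \<Longrightarrow> y \<in> carrier H \<Longrightarrow> hnorm H (x \<ominus> y) = hnorm H (y \<ominus> x)"
  by (simp add: hnorm_def)

lemma hnorm_triangle_minus: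
  assumes "x \<in> carrier H" "y \<in> carrier H" "z \<in> carrier H"
  shows "hnorm H (x \<ominus> z) \<le> hnorm H (x \<ominus> y) + hnorm H (y \<ominus> z)"
proof -
  have "x \<ominus> z = (x \<ominus> y) \<oplus> (y \<ominus> z)"
    by (rule ip_eqI) (simp_all add: assms)
  then show ?thesis using hnorm_triangle[of "x \<ominus> y" "y \<ominus> z"] assms by simp
qed

lemma parallelogram:
  assumes "x \<in> carrier H" "s \<in> carrier H" "t \<in> carrier H"
  shows "(hnorm H (s \<ominus> t))\<^sup>2 = 2 * (hnorm H (x \<ominus> s))\<^sup>2 + 2 * (hnorm H (x \<ominus> t))\<^sup>2
      - 4 * (hnorm H (x \<ominus> (1/2) \<odot>\<^bsub>H\<^esub> (s \<oplus> t)))\<^sup>2"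
  using assms by (simp add: hnorm_power2 ip_sym[of s x] ip_sym[of t x] ip_sym[of t s] field_simps)

text \<open>Since \<open>\<i> ^ n\<close> runs over the fourth roots of unity, summation with weight \<open>\<i> ^ n\<close> kills every
  term of the expansion of \<open>\<parallel>x + \<i> ^ n y\<parallel>\<^sup>2\<close> except the one containing \<open>\<langle>x, y\<rangle>\<close>.\<close>

lemma polarization:
  assumes "x \<in> carrier H" "y \<in> carrier H"
  shows "(\<Sum>n<4. \<i> ^ n * of_real ((hnorm H (x \<oplus> \<i> ^ n \<odot>\<^bsub>H\<^esub> y))\<^sup>2)) / 4 = ip H x y"
proof -
  have expand: "of_real ((hnorm H (x \<oplus> c \<odot>\<^bsub>H\<^esub> y))\<^sup>2)
      = ip H x x + cnj c * ip H x y + c * ip H y x + c * cnj c * ip H y y" for c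
    using assms by (subst ip_self[symmetric]) (simp_all add: algebra_simps)
  show ?thesis
    unfolding expand by (simp add: numeral_eq_Suc algebra_simps)
qed

definition bounded_functional :: "('v \<Rightarrow> complex) \<Rightarrow> bool" where
  "bounded_functional T \<longleftrightarrow>
     (\<forall>x\<in>carrier H. \<forall>y\<in>carrier H. T (x \<oplus> y) = T x + T y) \<and>
     (\<forall>c. \<forall>x\<in>carrier H. T (c \<odot>\<^bsub>H\<^esub> x) = c * T x) \<and>
     (\<exists>C. \<forall>x\<in>carrier H. cmod (T x) \<le> C * hnorm H x)"

definition closed_subspace :: "'v set \<Rightarrow> bool" where
  "closed_subspace S \<longleftrightarrow> S \<subseteq> carrier H \<and> \<zero> \<in> S \<and> (\<forall>x\<in>S. \<forall>y\<in>S. x \<oplus> y \<in> S) \<and>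
     (\<forall>c. \<forall>x\<in>S. c \<odot>\<^bsub>H\<^esub> x \<in> S) \<and>
     (\<forall>X x. range X \<subseteq> S \<longrightarrow> x \<in> carrier H \<longrightarrow> (\<lambda>n::nat. hnorm H (X n \<ominus> x)) \<longlonglongrightarrow> 0 \<longrightarrow> x \<in> S)"

lemma bounded_functional_minus:
  "bounded_functional T \<Longrightarrow> x \<in> carrier H \<Longrightarrow> y \<in> carrier H \<Longrightarrow> T (x \<ominus> y) = T x - T y"
  by (simp add: bounded_functional_def minus_via_smult)

lemma bounded_functional_scale_diff:
  assumes S: "bounded_functional S" and T: "bounded_functional T"
  shows "bounded_functional (\<lambda>x. a * (S x - T x))"
proof -
  from S obtain C where C: "\<forall>x\<in>carrier H. cmod (S x) \<le> C * hnorm H x"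
    unfolding bounded_functional_def by blast
  from T obtain D where D: "\<forall>x\<in>carrier H. cmod (T x) \<le> D * hnorm H x"
    unfolding bounded_functional_def by blast
  have "cmod (a * (S x - T x)) \<le> (cmod a * (C + D)) * hnorm H x" if x: "x \<in> carrier H" for x
  proof -
    have "cmod (S x - T x) \<le> (C + D) * hnorm H x"
      using C[rule_format, OF x] D[rule_format, OF x] norm_triangle_ineq4[of "S x" "T x"]
      by (simp add: algebra_simps)
    then have "cmod a * cmod (S x - T x) \<le> cmod a * ((C + D) * hnorm H x)"
      by (rule mult_left_mono) simp
    then show ?thesis by (simp add: norm_mult mult.assoc)
  qed
  then have "\<exists>B. \<forall>x\<in>carrier H. cmod (a * (S x - T x)) \<le> B * hnorm H x" by blast
  then show ?thesis
    using S T unfolding bounded_functional_def by (simp add: algebra_simps)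
qed

lemma closed_subspace_kernels:
  assumes "\<And>T. T \<in> F \<Longrightarrow> bounded_functional T"
  shows "closed_subspace {x \<in> carrier H. \<forall>T\<in>F. T x = 0}"
proof -
  have zero: "T \<zero> = 0" if "T \<in> F" for T
    using bounded_functional_minus[OF assms[OF that], of \<zero> \<zero>] by simp
  have limit: "T x = 0" if T: "T \<in> F" and X: "range X \<subseteq> {x \<in> carrier H. \<forall>T\<in>F. T x = 0}"
    and x: "x \<in> carrier H" and lim: "(\<lambda>n::nat. hnorm H (X n \<ominus> x)) \<longlonglongrightarrow> 0" for T X x
  proof -
    obtain C where C: "\<And>y. y \<in> carrier H \<Longrightarrow> cmod (T y) \<le> C * hnorm H y"
      using assms[OF T] unfolding bounded_functional_def by blast
    have "cmod (T x) \<le> C * hnorm H (X n \<ominus> x)" for n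
    proof -
      have Xn: "X n \<in> carrier H" "T (X n) = 0" using X T by auto
      have "T (X n \<ominus> x) = - T x"
        using bounded_functional_minus[OF assms[OF T] Xn(1) x] Xn by simp
      then show ?thesis using C[of "X n \<ominus> x"] Xn x by simp
    qed
    moreover have "(\<lambda>n. C * hnorm H (X n \<ominus> x)) \<longlonglongrightarrow> C * 0"
      by (intro tendsto_mult tendsto_const lim)
    ultimately have "cmod (T x) \<le> C * 0"
      using LIMSEQ_le_const by blast
    then show ?thesis by simp
  qed
  have lin: "\<And>T x y. T \<in> F \<Longrightarrow> x \<in> carrier H \<Longrightarrow> y \<in> carrier H \<Longrightarrow> T (x \<oplus> y) = T x + T y"
    "\<And>T c x. T \<in> F \<Longrightarrow> x \<in> carrier H \<Longrightarrow> T (c \<odot>\<^bsub>H\<^esub> x) = c * T x"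
    using assms by (simp_all add: bounded_functional_def)
  show ?thesis
    unfolding closed_subspace_def
  proof (intro conjI allI impI ballI)
    fix X x
    assume "range X \<subseteq> {x \<in> carrier H. \<forall>T\<in>F. T x = 0}" "x \<in> carrier H"
      "(\<lambda>n::nat. hnorm H (X n \<ominus> x)) \<longlonglongrightarrow> 0"
    then show "x \<in> {x \<in> carrier H. \<forall>T\<in>F. T x = 0}" using limit by simp
  qed (auto simp: zero lin)
qed

end

locale hilb_space = ip_space H for H :: "('f, 'v) hilb" (structure) +
  assumes hs: "hilbert_space H"
begin

lemma complete:
  fixes X :: "nat \<Rightarrow> 'v"
  assumes X: "\<And>n. X n \<in> carrier H"
    and Cauchy: "\<And>e. e > 0 \<Longrightarrow> \<exists>N. \<forall>m\<ge>N. \<forall>n\<ge>N. hnorm H (X m \<ominus> X n) < e"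
  obtains x where "x \<in> carrier H" "(\<lambda>n. hnorm H (X n \<ominus> x)) \<longlonglongrightarrow> 0"
proof -
  have "\<exists>x\<in>carrier H. \<forall>e>0. \<exists>N. \<forall>n\<ge>N. hnorm H (X n \<ominus> x) < e"
    using hs Cauchy X unfolding hilbert_space_def by blast
  then obtain x where x: "x \<in> carrier H" "\<And>e. e > 0 \<Longrightarrow> \<exists>N. \<forall>n\<ge>N. hnorm H (X n \<ominus> x) < e"
    by blast
  show ?thesis
    by (rule that[OF x(1)]) (use x X in \<open>simp add: LIMSEQ_iff\<close>)
qed

text \<open>A minimizing sequence is Cauchy by the parallelogram law, because the midpoint of two of its
  members lies in \<open>S\<close> and hence is at least as far from \<open>x\<close> as the infimum.\<close>

lemma closest_point:
  assumes S: "closed_subspace S" and x: "x \<in> carrier H"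
  obtains s where "s \<in> S" "\<And>t. t \<in> S \<Longrightarrow> hnorm H (x \<ominus> s) \<le> hnorm H (x \<ominus> t)"
proof -
  have sub: "t \<in> carrier H" if "t \<in> S" for t
    using S that by (auto simp: closed_subspace_def)
  define \<delta> where "\<delta> = (INF t\<in>S. (hnorm H (x \<ominus> t))\<^sup>2)"
  have ne: "S \<noteq> {}" using S by (auto simp: closed_subspace_def)
  have bdd: "bdd_below ((\<lambda>t. (hnorm H (x \<ominus> t))\<^sup>2) ` S)"
    by (rule bdd_belowI[of _ 0]) auto
  have \<delta>_le: "\<delta> \<le> (hnorm H (x \<ominus> t))\<^sup>2" if "t \<in> S" for t
    unfolding \<delta>_def by (rule cINF_lower[OF bdd that])
  have "\<exists>t\<in>S. (hnorm H (x \<ominus> t))\<^sup>2 < \<delta> + 1 / real (Suc n)" for n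
    using cINF_less_iff[OF ne bdd, of "\<delta> + 1 / real (Suc n)"] unfolding \<delta>_def by simp
  then obtain X where XS: "\<And>n. X n \<in> S"
    and Xn: "\<And>n. (hnorm H (x \<ominus> X n))\<^sup>2 < \<delta> + 1 / real (Suc n)"
    by metis
  have XC: "X n \<in> carrier H" for n using XS sub by blast
  have gap: "(hnorm H (X m \<ominus> X n))\<^sup>2 \<le> 2 / real (Suc m) + 2 / real (Suc n)" for m n
  proof -
    have "(1/2) \<odot>\<^bsub>H\<^esub> (X m \<oplus> X n) \<in> S"
      using S XS by (simp add: closed_subspace_def)
    from \<delta>_le[OF this] parallelogram[OF x XC[of m] XC[of n]] Xn[of m] Xn[of n]
    have "(hnorm H (X m \<ominus> X n))\<^sup>2 \<le> 2 * (1 / real (Suc m)) + 2 * (1 / real (Suc n))" by linarith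
    then show ?thesis by simp
  qed
  have "\<exists>N. \<forall>m\<ge>N. \<forall>n\<ge>N. hnorm H (X m \<ominus> X n) < e" if e: "e > 0" for e
  proof -
    obtain N where N: "4 / e\<^sup>2 < real N" using reals_Archimedean2 by blast
    have "hnorm H (X m \<ominus> X n) < e" if "m \<ge> N" "n \<ge> N" for m n
    proof -
      have "2 / real (Suc j) < e\<^sup>2 / 2" if "j \<ge> N" for j
      proof -
        have "4 / e\<^sup>2 < real (Suc j)" using N that by linarith
        then show ?thesis using e by (simp add: field_simps)
      qed
      from this[of m] this[of n] that gap[of m n] have "(hnorm H (X m \<ominus> X n))\<^sup>2 < e\<^sup>2" by simp
      then show ?thesis using e by (simp add: power2_less_imp_less)
    qed
    then show ?thesis by blast
  qed
  then obtain s where s: "s \<in> carrier H" and lim: "(\<lambda>n. hnorm H (X n \<ominus> s)) \<longlonglongrightarrow> 0"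
    using complete[of X] XC by blast
  have sS: "s \<in> S"
    using S s lim XS unfolding closed_subspace_def by blast
  have "hnorm H (x \<ominus> s) \<le> hnorm H (x \<ominus> t)" if t: "t \<in> S" for t
  proof -
    have "hnorm H (x \<ominus> s) \<le> sqrt ((hnorm H (x \<ominus> t))\<^sup>2 + 1 / real (Suc n)) + hnorm H (X n \<ominus> s)" for n
    proof -
      have "hnorm H (x \<ominus> X n) \<le> sqrt ((hnorm H (x \<ominus> t))\<^sup>2 + 1 / real (Suc n))"
        by (rule real_le_rsqrt) (use Xn[of n] \<delta>_le[OF t] in linarith)
      then show ?thesis using hnorm_triangle_minus[OF x XC[of n] s] by linarith
    qed
    moreover have "(\<lambda>n. sqrt ((hnorm H (x \<ominus> t))\<^sup>2 + 1 / real (Suc n)) + hnorm H (X n \<ominus> s))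
        \<longlonglongrightarrow> sqrt ((hnorm H (x \<ominus> t))\<^sup>2 + 0) + 0"
      using LIMSEQ_inverse_real_of_nat by (intro tendsto_intros lim) (simp add: inverse_eq_divide)
    ultimately have "hnorm H (x \<ominus> s) \<le> sqrt ((hnorm H (x \<ominus> t))\<^sup>2 + 0) + 0"
      using LIMSEQ_le_const by blast
    then show ?thesis using x t sub by simp
  qed
  with sS show ?thesis by (rule that)
qed

text \<open>The error \<open>y = x - s\<close> of the closest point cannot be shortened by moving \<open>s\<close> along any
  \<open>t \<in> S\<close>; at the best multiple of \<open>t\<close> the gain is \<open>|\<langle>y, t\<rangle>|\<^sup>2 / \<parallel>t\<parallel>\<^sup>2\<close>, which is therefore \<open>0\<close>.\<close>

theorem projection:
  assumes S: "closed_subspace S" and x: "x \<in> carrier H"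
  obtains s where "s \<in> S" "x \<ominus> s \<in> orth_complement H S"
proof -
  obtain s where s: "s \<in> S" and min: "\<And>t. t \<in> S \<Longrightarrow> hnorm H (x \<ominus> s) \<le> hnorm H (x \<ominus> t)"
    using closest_point[OF S x] by blast
  have sub: "t \<in> carrier H" if "t \<in> S" for t
    using S that by (auto simp: closed_subspace_def)
  have "ip H (x \<ominus> s) t = 0" if t: "t \<in> S" for t
  proof (cases "t = \<zero>")
    case True
    then show ?thesis using x s sub by simp
  next
    case False
    note C = x sub[OF s] sub[OF t]
    define n where "n = (hnorm H t)\<^sup>2"
    have n: "n > 0" using False C hnorm_eq_0[of t] by (simp add: n_def)
    define y where "y = x \<ominus> s"
    have y: "y \<in> carrier H" using C by (simp add: y_def)
    define a where "a = ip H y t"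
    define c where "c = a / of_real n"
    have "s \<oplus> c \<odot>\<^bsub>H\<^esub> t \<in> S" using S s t by (simp add: closed_subspace_def)
    then have "(hnorm H (x \<ominus> s))\<^sup>2 \<le> (hnorm H (x \<ominus> (s \<oplus> c \<odot>\<^bsub>H\<^esub> t)))\<^sup>2"
      using min C by (intro power_mono) auto
    also have "x \<ominus> (s \<oplus> c \<odot>\<^bsub>H\<^esub> t) = y \<ominus> c \<odot>\<^bsub>H\<^esub> t"
      unfolding y_def by (rule ip_eqI) (simp_all add: C)
    also have "(hnorm H (y \<ominus> c \<odot>\<^bsub>H\<^esub> t))\<^sup>2 = Re (ip H (y \<ominus> c \<odot>\<^bsub>H\<^esub> t) (y \<ominus> c \<odot>\<^bsub>H\<^esub> t))"
      by (rule hnorm_power2) (simp add: C y)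
    also have "ip H (y \<ominus> c \<odot>\<^bsub>H\<^esub> t) (y \<ominus> c \<odot>\<^bsub>H\<^esub> t)
        = ip H y y - cnj c * a - c * cnj a + c * cnj c * of_real n"
      using C y ip_sym[OF y C(3)] ip_self[OF C(3)] by (simp add: a_def n_def algebra_simps)
    also have "\<dots> = of_real ((hnorm H y)\<^sup>2 - (cmod a)\<^sup>2 / n)"
      unfolding ip_self[OF y] c_def by (rule complete_square[OF n])
    finally have "(cmod a)\<^sup>2 / n \<le> 0" by (simp add: y_def)
    then have "(cmod a)\<^sup>2 \<le> 0" using n by (simp add: divide_le_0_iff)
    then have "a = 0" by simp
    then show ?thesis by (simp add: a_def y_def)
  qed
  then show ?thesis
    using s x sub by (intro that[OF s]) (auto simp: orth_complement_def)
qed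

text \<open>Suppose the bound fails.  Then the \<open>T n\<close> are unbounded on every ball: if
  \<open>T n u\<close> is large for some \<open>u\<close> of prescribed norm, then so is the value of \<open>T n\<close> at \<open>x + u\<close> or \<open>x - u\<close>.  By continuity one
  can pass, \<open>k\<close> after \<open>k\<close>, to a smaller ball on which some \<open>T n\<close> exceeds \<open>k\<close> throughout.  The
  centres of these nested balls converge to a point at which the family is unbounded.\<close>

theorem uniform_boundedness:
  fixes T :: "nat \<Rightarrow> 'v \<Rightarrow> complex"
  assumes T: "\<And>n. bounded_functional (T n)"
    and ptw: "\<And>x. x \<in> carrier H \<Longrightarrow> \<exists>B. \<forall>n. cmod (T n x) \<le> B"
  shows "\<exists>C. \<forall>n. \<forall>x\<in>carrier H. cmod (T n x) \<le> C * hnorm H x"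
proof (rule ccontr)
  assume "\<not> ?thesis"
  then have unb: "\<exists>n. \<exists>x\<in>carrier H. C * hnorm H x < cmod (T n x)" for C
    by (meson not_le)
  have add: "T n (x \<oplus> y) = T n x + T n y" if "x \<in> carrier H" "y \<in> carrier H" for n x y
    using T[of n] that by (simp add: bounded_functional_def)
  have scale: "T n (c \<odot>\<^bsub>H\<^esub> x) = c * T n x" if "x \<in> carrier H" for n c x
    using T[of n] that by (simp add: bounded_functional_def)
  have diff: "T n (x \<ominus> y) = T n x - T n y" if "x \<in> carrier H" "y \<in> carrier H" for n x y
    using bounded_functional_minus[OF T that] .
  have far: "\<exists>n. \<exists>y\<in>carrier H. hnorm H (y \<ominus> x) \<le> r \<and> k < cmod (T n y)"
    if x: "x \<in> carrier H" and r: "r > 0" and k: "k \<ge> 0" for x r k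
  proof -
    obtain n v where v: "v \<in> carrier H" "(k + 1) / r * hnorm H v < cmod (T n v)"
      using unb by blast
    have "v \<noteq> \<zero>" using v scale[of \<zero> n 0] by auto
    then have hv: "hnorm H v > 0" using v hnorm_eq_0[of v] hnorm_nonneg[of v] by linarith
    define u where "u = of_real (r / hnorm H v) \<odot>\<^bsub>H\<^esub> v"
    have u: "u \<in> carrier H" "hnorm H u = r"
      using v r hv by (simp_all add: u_def hnorm_smult norm_divide)
    have ku: "k < cmod (T n u)"
    proof -
      have "(k + 1) * hnorm H v < r * cmod (T n v)"
        using v r by (simp add: field_simps)
      then have "k + 1 < cmod (T n u)"
        using v r hv by (simp add: u_def scale norm_mult norm_divide field_simps)
      then show ?thesis by simp
    qed
    have "T n (x \<oplus> u) - T n (x \<ominus> u) = 2 * T n u"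
      using x u by (simp add: add diff)
    then have "2 * cmod (T n u) \<le> cmod (T n (x \<oplus> u)) + cmod (T n (x \<ominus> u))"
      by (metis norm_mult norm_numeral norm_triangle_ineq4)
    then have "cmod (T n u) \<le> cmod (T n (x \<oplus> u)) \<or> cmod (T n u) \<le> cmod (T n (x \<ominus> u))"
      by linarith
    then have "k < cmod (T n (x \<oplus> u)) \<or> k < cmod (T n (x \<ominus> u))" using ku by linarith
    moreover have "hnorm H ((x \<oplus> u) \<ominus> x) = r" "hnorm H ((x \<ominus> u) \<ominus> x) = r"
      using x u by (simp_all add: hnorm_def)
    moreover have "x \<oplus> u \<in> carrier H" "x \<ominus> u \<in> carrier H" using x u by simp_all
    ultimately show ?thesis by (metis order_refl)
  qed
  have step: "\<exists>y s. y \<in> carrier H \<and> 0 < s \<and> s \<le> r / 2 \<and> hnorm H (y \<ominus> x) \<le> r / 2 \<and>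
      (\<exists>n. \<forall>w\<in>carrier H. hnorm H (w \<ominus> y) \<le> s \<longrightarrow> k < cmod (T n w))"
    if x: "x \<in> carrier H" and r: "r > 0" and k: "k \<ge> 0" for x r k
  proof -
    obtain n y where y: "y \<in> carrier H" "hnorm H (y \<ominus> x) \<le> r / 2" "k + 1 < cmod (T n y)"
      using far[OF x, of "r / 2" "k + 1"] r k by auto
    obtain C where C: "\<And>w. w \<in> carrier H \<Longrightarrow> cmod (T n w) \<le> C * hnorm H w"
      using T[of n] unfolding bounded_functional_def by blast
    \<comment> \<open>On a ball of radius \<open>s\<close> the functional \<open>T n\<close> varies by at most \<open>1\<close>, the surplus gained above.\<close>
    define s where "s = min (r / 2) (1 / (\<bar>C\<bar> + 1))"
    have s: "s > 0" "s \<le> r / 2" "\<bar>C\<bar> * s \<le> 1"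
      using r by (auto simp: s_def min_def field_simps)
    have "k < cmod (T n w)" if w: "w \<in> carrier H" "hnorm H (w \<ominus> y) \<le> s" for w
    proof -
      have "cmod (T n w - T n y) \<le> C * hnorm H (w \<ominus> y)"
        using C[of "w \<ominus> y"] w y by (simp add: diff)
      also have "\<dots> \<le> \<bar>C\<bar> * s"
        using w y by (intro mult_mono) auto
      finally have "cmod (T n w - T n y) \<le> 1" using s by linarith
      moreover have "cmod (T n y) \<le> cmod (T n w) + cmod (T n w - T n y)"
        by (metis norm_minus_commute norm_triangle_sub)
      ultimately show ?thesis using y by linarith
    qed
    with y s show ?thesis by blast
  qed
  define good where "good = (\<lambda>p. fst p \<in> carrier H \<and> (0::real) < snd p)"
  define next_ball where "next_ball = (\<lambda>k p q. snd q \<le> snd p / 2 \<and>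
      hnorm H (fst q \<ominus> fst p) \<le> snd p / 2 \<and>
      (\<exists>n. \<forall>w\<in>carrier H. hnorm H (w \<ominus> fst q) \<le> snd q \<longrightarrow> real k < cmod (T n w)))"
  have "\<exists>g. \<forall>k. good (g k) \<and> next_ball k (g k) (g (Suc k))"
  proof (rule dependent_nat_choice)
    show "\<exists>p. good p" by (rule exI[of _ "(\<zero>, 1)"]) (simp add: good_def)
  next
    fix p k assume "good p"
    then show "\<exists>q. good q \<and> next_ball k p q"
      using step[of "fst p" "snd p" "real k"] unfolding good_def next_ball_def
      by (metis fst_conv of_nat_0_le_iff snd_conv)
  qed
  then obtain g where g: "\<And>k. good (g k)" and nb: "\<And>k. next_ball k (g k) (g (Suc k))" by blast
  define X where "X k = fst (g k)" for k
  define r where "r k = snd (g k)" for k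
  have X: "X k \<in> carrier H" and r: "0 < r k" for k
    using g[of k] by (auto simp: good_def X_def r_def)
  have rS: "r (Suc k) \<le> r k / 2" and XS: "hnorm H (X (Suc k) \<ominus> X k) \<le> r k / 2"
    and big: "\<exists>n. \<forall>w\<in>carrier H. hnorm H (w \<ominus> X (Suc k)) \<le> r (Suc k) \<longrightarrow> real k < cmod (T n w)" for k
    using nb[of k] by (auto simp: next_ball_def X_def r_def)
  have nested: "hnorm H (X (k + j) \<ominus> X k) \<le> r k - r (k + j)" for k j
  proof (induction j)
    case 0
    then show ?case using X by simp
  next
    case (Suc j)
    have "hnorm H (X (Suc (k + j)) \<ominus> X k)
        \<le> hnorm H (X (Suc (k + j)) \<ominus> X (k + j)) + hnorm H (X (k + j) \<ominus> X k)"
      using X by (intro hnorm_triangle_minus)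
    then show ?case using Suc XS[of "k + j"] rS[of "k + j"] by simp
  qed
  have r_pow: "r k \<le> r 0 / 2 ^ k" for k
  proof (induction k)
    case (Suc k)
    then show ?case using rS[of k] by simp
  qed simp
  have r_lim: "r \<longlonglongrightarrow> 0"
  proof (rule tendsto_sandwich)
    have "r k \<le> r 0 * (1 / 2) ^ k" for k
      unfolding power_one_over using r_pow[of k] by (simp only: mult_1_right times_divide_eq_right)
    then show "\<forall>\<^sub>F k in sequentially. r k \<le> r 0 * (1 / 2) ^ k" by (rule always_eventually[OF allI])
    show "\<forall>\<^sub>F k in sequentially. 0 \<le> r k"
      using r less_imp_le by (intro always_eventually allI) blast
    show "(\<lambda>k. r 0 * (1 / 2) ^ k) \<longlonglongrightarrow> 0"
      by (intro tendsto_mult_right_zero LIMSEQ_realpow_zero) auto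
  qed simp
  have close: "hnorm H (X n \<ominus> X k) \<le> r k" if "k \<le> n" for k n
    using nested[of k "n - k"] r[of n] that by simp
  have "\<exists>N. \<forall>m\<ge>N. \<forall>n\<ge>N. hnorm H (X m \<ominus> X n) < e" if e: "e > 0" for e
  proof -
    obtain N where N: "r N < e / 2"
      using order_tendstoD(2)[OF r_lim, of "e / 2"] e by (auto simp: eventually_sequentially)
    have "hnorm H (X m \<ominus> X n) < e" if "m \<ge> N" "n \<ge> N" for m n
      using hnorm_triangle_minus[OF X[of m] X[of N] X[of n]] close[OF that(1)] close[OF that(2)] N
        hnorm_minus_commute[OF X X, of N n] by linarith
    then show ?thesis by blast
  qed
  then obtain x where x: "x \<in> carrier H" and lim: "(\<lambda>n. hnorm H (X n \<ominus> x)) \<longlonglongrightarrow> 0"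
    using complete[of X] X by blast
  have near: "hnorm H (x \<ominus> X k) \<le> r k" for k
  proof -
    have "hnorm H (x \<ominus> X k) \<le> hnorm H (X n \<ominus> x) + r k" if "n \<ge> k" for n
      using hnorm_triangle_minus[OF x X[of n] X[of k]] close[OF that] hnorm_minus_commute[OF x X, of n]
      by linarith
    moreover have "(\<lambda>n. hnorm H (X n \<ominus> x) + r k) \<longlonglongrightarrow> 0 + r k"
      by (intro tendsto_intros lim)
    ultimately have "hnorm H (x \<ominus> X k) \<le> 0 + r k"
      using LIMSEQ_le_const by blast
    then show ?thesis by simp
  qed
  obtain B where B: "\<And>n. cmod (T n x) \<le> B" using ptw[OF x] by blast
  obtain k where k: "B < real k" using reals_Archimedean2 by blast
  obtain n where "real k < cmod (T n x)" using big[of k] near x by blast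
  then show False using B[of n] k by linarith
qed

text \<open>This is the form in which uniform boundedness is used below: it makes derivatives bounded
  once evaluations are.\<close>

corollary bounded_functional_limit:
  assumes T: "\<And>n. bounded_functional (T n)"
    and lim: "\<And>x. x \<in> carrier H \<Longrightarrow> (\<lambda>n::nat. T n x) \<longlonglongrightarrow> L x"
  shows "bounded_functional L"
proof -
  have "\<exists>C. \<forall>n. \<forall>x\<in>carrier H. cmod (T n x) \<le> C * hnorm H x"
  proof (rule uniform_boundedness[OF T])
    show "\<exists>B. \<forall>n. cmod (T n x) \<le> B" if "x \<in> carrier H" for x
      using convergent_imp_Bseq[OF convergentI[OF lim[OF that]]] by (auto simp: Bseq_def)
  qed
  then obtain C where C: "\<And>n x. x \<in> carrier H \<Longrightarrow> cmod (T n x) \<le> C * hnorm H x"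
    by auto
  have "cmod (L x) \<le> C * hnorm H x" if "x \<in> carrier H" for x
    using LIMSEQ_le_const2[OF tendsto_norm[OF lim[OF that]]] C[OF that] by blast
  moreover have "L (x \<oplus> y) = L x + L y" if "x \<in> carrier H" "y \<in> carrier H" for x y
  proof (rule LIMSEQ_unique)
    show "(\<lambda>n. T n (x \<oplus> y)) \<longlonglongrightarrow> L (x \<oplus> y)" using lim that by simp
    have "T n (x \<oplus> y) = T n x + T n y" for n
      using T[of n] that by (simp add: bounded_functional_def)
    then show "(\<lambda>n. T n (x \<oplus> y)) \<longlonglongrightarrow> L x + L y"
      using tendsto_add[OF lim[OF that(1)] lim[OF that(2)]] by simp
  qed
  moreover have "L (c \<odot>\<^bsub>H\<^esub> x) = c * L x" if "x \<in> carrier H" for c x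
  proof (rule LIMSEQ_unique)
    show "(\<lambda>n. T n (c \<odot>\<^bsub>H\<^esub> x)) \<longlonglongrightarrow> L (c \<odot>\<^bsub>H\<^esub> x)" using lim that by simp
    have "T n (c \<odot>\<^bsub>H\<^esub> x) = c * T n x" for n
      using T[of n] that by (simp add: bounded_functional_def)
    then show "(\<lambda>n. T n (c \<odot>\<^bsub>H\<^esub> x)) \<longlonglongrightarrow> c * L x"
      using tendsto_mult_left[OF lim[OF that]] by simp
  qed
  ultimately show ?thesis unfolding bounded_functional_def by blast
qed

end

section \<open>Quotients and transport of Hilbert modules\<close>

lemma (in ip_space) cring_complex_ring: "cring complex_ring"
  by (rule module.axioms(1)[OF module_H])

lemma (in ip_space) abelian_group_H: "abelian_group H"
  by (rule module.axioms(2)[OF module_H])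

text \<open>The axioms spelled out on the carrier, so that they can be checked for a record that shares
  only part of its fields with a known space.\<close>

lemma inner_product_spaceI:
  assumes "abelian_group K" and "cring complex_ring"
    and "\<And>c x. x \<in> carrier K \<Longrightarrow> c \<odot>\<^bsub>K\<^esub> x \<in> carrier K"
    and "\<And>a b x. x \<in> carrier K \<Longrightarrow> (a + b) \<odot>\<^bsub>K\<^esub> x = a \<odot>\<^bsub>K\<^esub> x \<oplus>\<^bsub>K\<^esub> b \<odot>\<^bsub>K\<^esub> x"
    and "\<And>c x y. x \<in> carrier K \<Longrightarrow> y \<in> carrier K \<Longrightarrow>
      c \<odot>\<^bsub>K\<^esub> (x \<oplus>\<^bsub>K\<^esub> y) = c \<odot>\<^bsub>K\<^esub> x \<oplus>\<^bsub>K\<^esub> c \<odot>\<^bsub>K\<^esub> y"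
    and "\<And>a b x. x \<in> carrier K \<Longrightarrow> (a * b) \<odot>\<^bsub>K\<^esub> x = a \<odot>\<^bsub>K\<^esub> (b \<odot>\<^bsub>K\<^esub> x)"
    and "\<And>x. x \<in> carrier K \<Longrightarrow> 1 \<odot>\<^bsub>K\<^esub> x = x"
    and "\<And>x y. x \<in> carrier K \<Longrightarrow> y \<in> carrier K \<Longrightarrow> ip K y x = cnj (ip K x y)"
    and "\<And>x y z. x \<in> carrier K \<Longrightarrow> y \<in> carrier K \<Longrightarrow> z \<in> carrier K \<Longrightarrow>
      ip K (x \<oplus>\<^bsub>K\<^esub> y) z = ip K x z + ip K y z"
    and "\<And>c x y. x \<in> carrier K \<Longrightarrow> y \<in> carrier K \<Longrightarrow> ip K (c \<odot>\<^bsub>K\<^esub> x) y = c * ip K x y"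
    and "\<And>x. x \<in> carrier K \<Longrightarrow> 0 \<le> Re (ip K x x)"
    and "\<And>x. x \<in> carrier K \<Longrightarrow> ip K x x = 0 \<Longrightarrow> x = \<zero>\<^bsub>K\<^esub>"
  shows "inner_product_space K"
proof -
  have "module complex_ring K"
    using assms(1-7) by (intro moduleI) simp_all
  then show ?thesis
    unfolding inner_product_space_def using assms(8-) by blast
qed

lemma hilbert_spaceI:
  fixes K :: "('f, 'v) hilb"
  assumes "inner_product_space K"
    and "\<And>X. (\<And>n::nat. X n \<in> carrier K) \<Longrightarrow>
      \<forall>e>0. \<exists>N. \<forall>m\<ge>N. \<forall>n\<ge>N. hnorm K (X m \<ominus>\<^bsub>K\<^esub> X n) < e \<Longrightarrow>
      \<exists>x\<in>carrier K. (\<lambda>n. hnorm K (X n \<ominus>\<^bsub>K\<^esub> x)) \<longlonglongrightarrow> 0"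
  shows "hilbert_space K"
proof -
  interpret ip_space K by unfold_locales (rule assms)
  have "\<exists>x\<in>carrier K. \<forall>e>0. \<exists>N. \<forall>n\<ge>N. hnorm K (X n \<ominus>\<^bsub>K\<^esub> x) < e"
    if X: "range X \<subseteq> carrier K"
      and C: "\<forall>e>0. \<exists>N. \<forall>m\<ge>N. \<forall>n\<ge>N. hnorm K (X m \<ominus>\<^bsub>K\<^esub> X n) < e" for X :: "nat \<Rightarrow> 'v"
  proof -
    have Xn: "X n \<in> carrier K" for n using X by auto
    obtain x where "x \<in> carrier K" "(\<lambda>n. hnorm K (X n \<ominus>\<^bsub>K\<^esub> x)) \<longlonglongrightarrow> 0"
      using assms(2)[OF Xn C] by blast
    then show ?thesis using Xn by (intro bexI[of _ x]) (simp_all add: LIMSEQ_iff)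
  qed
  then show ?thesis using assms(1) unfolding hilbert_space_def by blast
qed

text \<open>The action of the algebra lives on a record that differs from \<open>H\<close> only in its scalar
  multiplication.\<close>

abbreviation (input) action_module where
  "action_module H \<equiv> \<lparr>carrier = carrier H, mult = mult H, one = one H, zero = zero H, add = add H,
        smult = act H\<rparr>"

lemma abelian_group_cong:
  assumes "abelian_group A" "carrier B = carrier A" "add B = add A" "zero B = zero A"
  shows "abelian_group B"
proof -
  interpret A: abelian_group A by (rule assms)
  show ?thesis
    by (rule abelian_groupI)
      (use A.a_comm A.a_assoc A.l_neg A.a_inv_closed in \<open>auto simp: assms(2-)\<close>)
qed

lemma hilbert_moduleI:
  assumes "hilbert_space K" and "cring (ring_A \<Omega>)"
    and "\<And>f x. f \<in> algebra_A \<Omega> \<Longrightarrow> x \<in> carrier K \<Longrightarrow> act K f x \<in> carrier K"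
    and "\<And>f g x. f \<in> algebra_A \<Omega> \<Longrightarrow> g \<in> algebra_A \<Omega> \<Longrightarrow> x \<in> carrier K \<Longrightarrow>
      act K (f \<oplus>\<^bsub>ring_A \<Omega>\<^esub> g) x = act K f x \<oplus>\<^bsub>K\<^esub> act K g x"
    and "\<And>f x y. f \<in> algebra_A \<Omega> \<Longrightarrow> x \<in> carrier K \<Longrightarrow> y \<in> carrier K \<Longrightarrow>
      act K f (x \<oplus>\<^bsub>K\<^esub> y) = act K f x \<oplus>\<^bsub>K\<^esub> act K f y"
    and "\<And>f g x. f \<in> algebra_A \<Omega> \<Longrightarrow> g \<in> algebra_A \<Omega> \<Longrightarrow> x \<in> carrier K \<Longrightarrow>
      act K (f \<otimes>\<^bsub>ring_A \<Omega>\<^esub> g) x = act K f (act K g x)"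
    and "\<And>x. x \<in> carrier K \<Longrightarrow> act K \<one>\<^bsub>ring_A \<Omega>\<^esub> x = x"
    and "\<And>c x. x \<in> carrier K \<Longrightarrow> act K (\<lambda>z\<in>closure \<Omega>. c) x = c \<odot>\<^bsub>K\<^esub> x"
    and "\<And>f x e. f \<in> algebra_A \<Omega> \<Longrightarrow> x \<in> carrier K \<Longrightarrow> e > 0 \<Longrightarrow>
      \<exists>\<delta>>0. \<forall>g\<in>algebra_A \<Omega>. \<forall>y\<in>carrier K.
          sup_dist \<Omega> g f < \<delta> \<longrightarrow> hnorm K (y \<ominus>\<^bsub>K\<^esub> x) < \<delta> \<longrightarrow>
          hnorm K (act K g y \<ominus>\<^bsub>K\<^esub> act K f x) < e"
  shows "hilbert_module \<Omega> K"
proof -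
  interpret ip_space K
    using assms(1) by unfold_locales (simp add: hilbert_space_def)
  have R: "carrier (ring_A \<Omega>) = algebra_A \<Omega>" by (simp add: ring_A_def)
  have "abelian_group (action_module K)"
    by (rule abelian_group_cong[OF abelian_group_H]) simp_all
  then have "module (ring_A \<Omega>) (action_module K)"
    using assms(2-7) by (intro moduleI) (simp_all add: R)
  then show ?thesis
    unfolding hilbert_module_def using assms(1,8,9) by blast
qed

locale hilb_module = hilb_space H
  for H :: "('m::finite cvec \<Rightarrow> complex, 'v) hilb" (structure) and \<Omega> :: "'m cvec set" +
  assumes hm: "hilbert_module \<Omega> H"
begin

lemma action_module: "module (ring_A \<Omega>) (action_module H)"
  using hm unfolding hilbert_module_def by blast

lemma carrier_ring_A: "carrier (ring_A \<Omega>) = algebra_A \<Omega>"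
  by (simp add: ring_A_def)

lemma cring_ring_A: "cring (ring_A \<Omega>)"
  by (rule module.axioms(1)[OF action_module])

lemma act_closed [simp]: "f \<in> algebra_A \<Omega> \<Longrightarrow> x \<in> carrier H \<Longrightarrow> act H f x \<in> carrier H"
  using module.smult_closed[OF action_module] by (simp add: carrier_ring_A)

lemma act_add_left: "f \<in> algebra_A \<Omega> \<Longrightarrow> g \<in> algebra_A \<Omega> \<Longrightarrow> x \<in> carrier H \<Longrightarrow>
    act H (f \<oplus>\<^bsub>ring_A \<Omega>\<^esub> g) x = act H f x \<oplus> act H g x"
  using module.smult_l_distr[OF action_module] by (simp add: carrier_ring_A)

lemma act_add_right: "f \<in> algebra_A \<Omega> \<Longrightarrow> x \<in> carrier H \<Longrightarrow> y \<in> carrier H \<Longrightarrow>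
    act H f (x \<oplus> y) = act H f x \<oplus> act H f y"
  using module.smult_r_distr[OF action_module] by (simp add: carrier_ring_A)

lemma act_mult: "f \<in> algebra_A \<Omega> \<Longrightarrow> g \<in> algebra_A \<Omega> \<Longrightarrow> x \<in> carrier H \<Longrightarrow>
    act H (f \<otimes>\<^bsub>ring_A \<Omega>\<^esub> g) x = act H f (act H g x)"
  using module.smult_assoc1[OF action_module] by (simp add: carrier_ring_A)

lemma act_one: "x \<in> carrier H \<Longrightarrow> act H \<one>\<^bsub>ring_A \<Omega>\<^esub> x = x"
  using module.smult_one[OF action_module] by simp

lemma act_const: "x \<in> carrier H \<Longrightarrow> act H (\<lambda>z\<in>closure \<Omega>. c) x = c \<odot>\<^bsub>H\<^esub> x"
  using hm unfolding hilbert_module_def by blast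

lemma act_continuous:
  "f \<in> algebra_A \<Omega> \<Longrightarrow> x \<in> carrier H \<Longrightarrow> e > 0 \<Longrightarrow>
      \<exists>\<delta>>0. \<forall>g\<in>algebra_A \<Omega>. \<forall>y\<in>carrier H.
          sup_dist \<Omega> g f < \<delta> \<longrightarrow> hnorm H (y \<ominus> x) < \<delta> \<longrightarrow>
          hnorm H (act H g y \<ominus> act H f x) < e"
  using hm unfolding hilbert_module_def by blast

lemma act_minus:
  assumes f: "f \<in> algebra_A \<Omega>" and x: "x \<in> carrier H" and y: "y \<in> carrier H"
  shows "act H f (x \<ominus> y) = act H f x \<ominus> act H f y"
proof -
  have "(x \<ominus> y) \<oplus> y = x"
    by (rule ip_eqI) (simp_all add: x y)
  then have "act H f x = act H f (x \<ominus> y) \<oplus> act H f y"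
    using act_add_right[OF f, of "x \<ominus> y" y] x y by simp
  then show ?thesis
    by (intro ip_eqI) (simp_all add: f x y)
qed

end

lemma const_in_algebra_A: "(\<lambda>z\<in>closure \<Omega>. c) \<in> algebra_A \<Omega>"
proof -
  have "holomorphic_several (\<lambda>_. c) UNIV"
    unfolding holomorphic_several_def by (auto intro!: exI[of _ "\<lambda>_. 0"])
  then show ?thesis
    unfolding algebra_A_def by (auto intro!: exI[of _ "\<lambda>_. c"] exI[of _ UNIV])
qed

lemma hilb_moduleI: "hilbert_module \<Omega> H \<Longrightarrow> hilb_module H \<Omega>"
  by unfold_locales (simp_all add: hilbert_module_def hilbert_space_def)

text \<open>Closedness provides the projection; invariance makes the compression of the action to the
  orthogonal complement multiplicative.\<close>

locale closed_submodule = hilb_module H \<Omega>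
  for H :: "('m::finite cvec \<Rightarrow> complex, 'v) hilb" (structure) and \<Omega> :: "'m cvec set" +
  fixes S :: "'v set"
  assumes S: "closed_subspace S"
    and act_S: "\<And>f s. f \<in> algebra_A \<Omega> \<Longrightarrow> s \<in> S \<Longrightarrow> act H f s \<in> S"
begin

abbreviation "Q \<equiv> orth_complement H S"
abbreviation "P \<equiv> orth_proj H Q"

lemma S_carrier: "s \<in> S \<Longrightarrow> s \<in> carrier H"
  using S by (auto simp: closed_subspace_def)

lemma Q_carrier: "x \<in> Q \<Longrightarrow> x \<in> carrier H"
  by (simp add: orth_complement_def)

lemma S_add: "s \<in> S \<Longrightarrow> t \<in> S \<Longrightarrow> s \<oplus> t \<in> S"
  using S by (simp add: closed_subspace_def)

lemma S_smult: "s \<in> S \<Longrightarrow> c \<odot>\<^bsub>H\<^esub> s \<in> S"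
  using S by (simp add: closed_subspace_def)

lemma S_minus: "s \<in> S \<Longrightarrow> t \<in> S \<Longrightarrow> s \<ominus> t \<in> S"
  by (simp add: minus_via_smult S_carrier S_add S_smult)

lemma orthogonal: "x \<in> Q \<Longrightarrow> s \<in> S \<Longrightarrow> ip H x s = 0"
  by (simp add: orth_complement_def)

lemma orthogonal_left: "x \<in> Q \<Longrightarrow> s \<in> S \<Longrightarrow> ip H s x = 0"
  using ip_sym[of x s] by (simp add: orthogonal Q_carrier S_carrier)

lemma Q_zero: "\<zero> \<in> Q"
  by (simp add: orth_complement_def S_carrier)

lemma Q_add: "x \<in> Q \<Longrightarrow> y \<in> Q \<Longrightarrow> x \<oplus> y \<in> Q"
  by (simp add: orth_complement_def S_carrier)

lemma Q_smult: "x \<in> Q \<Longrightarrow> c \<odot>\<^bsub>H\<^esub> x \<in> Q"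
  by (simp add: orth_complement_def S_carrier)

lemma Q_minus: "x \<in> Q \<Longrightarrow> y \<in> Q \<Longrightarrow> x \<ominus> y \<in> Q"
  by (simp add: orth_complement_def S_carrier)

lemma Q_inter_S: "x \<in> Q \<Longrightarrow> x \<in> S \<Longrightarrow> x = \<zero>"
  using orthogonal ip_self_eq_0 Q_carrier by blast

lemma P_eqI:
  assumes x: "x \<in> carrier H" and y: "y \<in> Q" and xy: "x \<ominus> y \<in> S"
  shows "P x = y"
  unfolding orth_proj_def
proof (rule the_equality)
  show "y \<in> Q \<and> (\<forall>s\<in>Q. ip H (x \<ominus> y) s = 0)"
    using assms orthogonal_left by blast
next
  fix w assume w: "w \<in> Q \<and> (\<forall>s\<in>Q. ip H (x \<ominus> w) s = 0)"
  have C: "w \<in> carrier H" "y \<in> carrier H" using w y Q_carrier by auto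
  have q: "w \<ominus> y \<in> Q" using w y by (simp add: Q_minus)
  obtain v where v: "v = w \<ominus> y" "v \<in> carrier H" using C by simp
  have "ip H (x \<ominus> w) v = 0" "ip H (x \<ominus> y) v = 0"
    unfolding v(1) using w q orthogonal_left[OF q xy] by auto
  then have "ip H (w \<ominus> y) v = 0"
    using x C v(2) by simp
  then have "ip H (w \<ominus> y) (w \<ominus> y) = 0" by (simp add: v(1))
  then have "w \<ominus> y = \<zero>" using C by (simp add: ip_self_eq_0)
  then show "w = y" using C by (simp add: minus_eq_zero_iff)
qed

lemma
  assumes x: "x \<in> carrier H"
  shows P_in_Q: "P x \<in> Q" and minus_P_in_S: "x \<ominus> P x \<in> S"
proof -
  obtain s where s: "s \<in> S" "x \<ominus> s \<in> Q" using projection[OF S x] by blast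
  have "x \<ominus> (x \<ominus> s) = s"
    by (rule ip_eqI) (simp_all add: x S_carrier s)
  then have "P x = x \<ominus> s" "x \<ominus> (x \<ominus> s) \<in> S"
    using P_eqI[OF x s(2)] s by auto
  then show "P x \<in> Q" "x \<ominus> P x \<in> S" using s by auto
qed

lemma P_carrier [simp]: "x \<in> carrier H \<Longrightarrow> P x \<in> carrier H"
  using P_in_Q Q_carrier by blast

text \<open>The projection depends only on the class modulo \<open>S\<close>, which identifies the orthogonal
  complement with the quotient by \<open>S\<close>.\<close>

lemma P_cong_S:
  assumes x: "x \<in> carrier H" and y: "y \<in> carrier H" and xy: "x \<ominus> y \<in> S"
  shows "P x = P y"
proof (rule P_eqI[OF x P_in_Q[OF y]])
  have "x \<ominus> P y = (x \<ominus> y) \<oplus> (y \<ominus> P y)"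
    by (rule ip_eqI) (simp_all add: x y)
  then show "x \<ominus> P y \<in> S" using xy minus_P_in_S[OF y] by (simp add: S_add)
qed

lemma P_id: "x \<in> Q \<Longrightarrow> P x = x"
  by (rule P_eqI) (use S in \<open>auto simp: Q_carrier closed_subspace_def\<close>)

lemma P_add:
  assumes x: "x \<in> carrier H" and y: "y \<in> carrier H"
  shows "P (x \<oplus> y) = P x \<oplus> P y"
proof (rule P_eqI)
  have "(x \<oplus> y) \<ominus> (P x \<oplus> P y) = (x \<ominus> P x) \<oplus> (y \<ominus> P y)"
    by (rule ip_eqI) (simp_all add: x y)
  then show "(x \<oplus> y) \<ominus> (P x \<oplus> P y) \<in> S"
    using minus_P_in_S x y by (simp add: S_add)
qed (simp_all add: x y P_in_Q Q_add)

lemma P_minus: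
  assumes x: "x \<in> carrier H" and y: "y \<in> carrier H"
  shows "P (x \<ominus> y) = P x \<ominus> P y"
proof (rule P_eqI)
  have "(x \<ominus> y) \<ominus> (P x \<ominus> P y) = (x \<ominus> P x) \<ominus> (y \<ominus> P y)"
    by (rule ip_eqI) (simp_all add: x y)
  then show "(x \<ominus> y) \<ominus> (P x \<ominus> P y) \<in> S"
    using minus_P_in_S x y by (simp add: S_minus)
qed (simp_all add: x y P_in_Q Q_minus)

lemma hnorm_add_orthogonal_ge:
  assumes x: "x \<in> Q" and s: "s \<in> S"
  shows "hnorm H x \<le> hnorm H (x \<oplus> s)"
proof (rule power2_le_imp_le)
  show "(hnorm H x)\<^sup>2 \<le> (hnorm H (x \<oplus> s))\<^sup>2"
    using x s by (simp add: hnorm_power2 Q_carrier S_carrier orthogonal orthogonal_left Re_ip_self_nonneg)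
qed (simp add: x s Q_carrier S_carrier)

lemma hnorm_P_le:
  assumes x: "x \<in> carrier H"
  shows "hnorm H (P x) \<le> hnorm H x"
proof -
  have "P x \<oplus> (x \<ominus> P x) = x"
    by (rule ip_eqI) (simp_all add: x)
  then show ?thesis
    using hnorm_add_orthogonal_ge[OF P_in_Q[OF x] minus_P_in_S[OF x]] by simp
qed

lemma quotient_simps [simp]:
  "carrier (quotient_module H S) = Q" "add (quotient_module H S) = add H"
  "zero (quotient_module H S) = zero H" "smult (quotient_module H S) = smult H"
  "ip (quotient_module H S) = ip H" "act (quotient_module H S) = (\<lambda>f x. P (act H f x))"
  "hnorm (quotient_module H S) = hnorm H"
  by (simp_all add: quotient_module_def hnorm_def fun_eq_iff)

lemma inner_product_space_quotient: "inner_product_space (quotient_module H S)"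
proof (rule inner_product_spaceI)
  show "abelian_group (quotient_module H S)"
  proof (rule abelian_groupI)
    fix x assume "x \<in> carrier (quotient_module H S)"
    then have x: "x \<in> Q" by simp
    have "(-1) \<odot>\<^bsub>H\<^esub> x \<oplus> x = \<zero>"
      by (rule ip_eqI) (use x in \<open>simp_all add: Q_carrier\<close>)
    then show "\<exists>y\<in>carrier (quotient_module H S).
        y \<oplus>\<^bsub>quotient_module H S\<^esub> x = \<zero>\<^bsub>quotient_module H S\<^esub>"
      using Q_smult[OF x] by (intro bexI[of _ "(-1) \<odot>\<^bsub>H\<^esub> x"]) simp_all
  qed (simp_all add: Q_add Q_zero Q_carrier M.a_assoc M.a_comm M.a_lcomm)
  show "cring complex_ring" by (rule cring_complex_ring)
next
  fix a b x assume "x \<in> carrier (quotient_module H S)"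
  then have x: "x \<in> carrier H" by (simp add: Q_carrier)
  show "(a + b) \<odot>\<^bsub>quotient_module H S\<^esub> x =
      a \<odot>\<^bsub>quotient_module H S\<^esub> x \<oplus>\<^bsub>quotient_module H S\<^esub> b \<odot>\<^bsub>quotient_module H S\<^esub> x"
    using smult_l_distr[of a b x] x by simp
  show "(a * b) \<odot>\<^bsub>quotient_module H S\<^esub> x =
      a \<odot>\<^bsub>quotient_module H S\<^esub> (b \<odot>\<^bsub>quotient_module H S\<^esub> x)"
    using smult_assoc1[of a b x] x by simp
  show "1 \<odot>\<^bsub>quotient_module H S\<^esub> x = x"
    using smult_one[of x] x by simp
qed (simp_all add: Q_carrier Q_smult smult_r_distr ip_sym[symmetric] Re_ip_self_nonneg ip_self_eq_0)

text \<open>Subtraction is defined through inverses, which refer to the carrier; expressing it by the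
  scalar \<open>-1\<close> shows that the smaller carrier does not change it.\<close>

lemma quotient_minus:
  assumes "x \<in> Q" "y \<in> Q"
  shows "x \<ominus>\<^bsub>quotient_module H S\<^esub> y = x \<ominus> y"
proof -
  interpret K: ip_space "quotient_module H S"
    by unfold_locales (rule inner_product_space_quotient)
  show ?thesis
    using K.minus_via_smult[of x y] assms by (simp add: minus_via_smult Q_carrier)
qed

text \<open>A Cauchy sequence in the complement has a limit \<open>x\<close> in \<open>H\<close>; it also converges to \<open>P x\<close>, as
  \<open>P\<close> is contractive and fixes the sequence.\<close>

lemma hilbert_space_quotient: "hilbert_space (quotient_module H S)"
proof (rule hilbert_spaceI[OF inner_product_space_quotient])
  fix X :: "nat \<Rightarrow> 'v"
  assume "\<And>n. X n \<in> carrier (quotient_module H S)"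
  then have X: "\<And>n. X n \<in> Q" by simp
  then have XC: "\<And>n. X n \<in> carrier H" by (rule Q_carrier)
  assume "\<forall>e>0. \<exists>N. \<forall>m\<ge>N. \<forall>n\<ge>N.
      hnorm (quotient_module H S) (X m \<ominus>\<^bsub>quotient_module H S\<^esub> X n) < e"
  then have "\<And>e. e > 0 \<Longrightarrow> \<exists>N. \<forall>m\<ge>N. \<forall>n\<ge>N. hnorm H (X m \<ominus> X n) < e"
    by (simp add: quotient_minus X)
  then obtain x where x: "x \<in> carrier H" and lim: "(\<lambda>n. hnorm H (X n \<ominus> x)) \<longlonglongrightarrow> 0"
    using complete[of X] XC by blast
  have "(\<lambda>n. hnorm H (X n \<ominus> P x)) \<longlonglongrightarrow> 0"
  proof (rule tendsto_sandwich[OF _ _ tendsto_const lim])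
    have "hnorm H (X n \<ominus> P x) \<le> hnorm H (X n \<ominus> x)" for n
      using hnorm_P_le[of "X n \<ominus> x"] P_minus[of "X n" x] P_id[OF X] XC x by simp
    then show "\<forall>\<^sub>F n in sequentially. hnorm H (X n \<ominus> P x) \<le> hnorm H (X n \<ominus> x)"
      by (intro always_eventually allI)
    show "\<forall>\<^sub>F n in sequentially. 0 \<le> hnorm H (X n \<ominus> P x)"
      by (intro always_eventually allI hnorm_nonneg) (simp add: XC x)
  qed
  then show "\<exists>x\<in>carrier (quotient_module H S).
      (\<lambda>n. hnorm (quotient_module H S) (X n \<ominus>\<^bsub>quotient_module H S\<^esub> x)) \<longlonglongrightarrow> 0"
    using P_in_Q[OF x] X by (intro bexI[of _ "P x"]) (simp_all add: quotient_minus)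
qed

text \<open>Because \<open>S\<close> is invariant, inserting a projection before acting changes nothing modulo \<open>S\<close>.
  This gives associativity of the compressed action.\<close>

lemma P_act_P:
  assumes f: "f \<in> algebra_A \<Omega>" and x: "x \<in> carrier H"
  shows "P (act H f (P x)) = P (act H f x)"
proof (rule P_cong_S[symmetric])
  have "act H f x \<ominus> act H f (P x) = act H f (x \<ominus> P x)"
    using f x by (simp add: act_minus)
  then show "act H f x \<ominus> act H f (P x) \<in> S"
    using act_S[OF f minus_P_in_S[OF x]] by simp
qed (simp_all add: f x)

theorem hilbert_module_quotient: "hilbert_module \<Omega> (quotient_module H S)"
proof (rule hilbert_moduleI[OF hilbert_space_quotient cring_ring_A])
  fix f x and e :: real
  assume f: "f \<in> algebra_A \<Omega>" and "x \<in> carrier (quotient_module H S)" and e: "e > 0"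
  then have x: "x \<in> Q" by simp
  obtain \<delta> where \<delta>: "\<delta> > 0" and cont: "\<And>g y. g \<in> algebra_A \<Omega> \<Longrightarrow> y \<in> carrier H \<Longrightarrow>
      sup_dist \<Omega> g f < \<delta> \<Longrightarrow> hnorm H (y \<ominus> x) < \<delta> \<Longrightarrow> hnorm H (act H g y \<ominus> act H f x) < e"
    using act_continuous[OF f Q_carrier[OF x] e] by blast
  have "hnorm H (P (act H g y) \<ominus> P (act H f x)) < e"
    if g: "g \<in> algebra_A \<Omega>" and y: "y \<in> Q" and d: "sup_dist \<Omega> g f < \<delta>" "hnorm H (y \<ominus> x) < \<delta>" for g y
  proof -
    have "hnorm H (P (act H g y \<ominus> act H f x)) \<le> hnorm H (act H g y \<ominus> act H f x)"
      by (rule hnorm_P_le) (simp add: f g x y Q_carrier)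
    also have "\<dots> < e" using cont[OF g Q_carrier[OF y] d] .
    finally show ?thesis using f g x y by (simp add: P_minus Q_carrier)
  qed
  then show "\<exists>\<delta>>0. \<forall>g\<in>algebra_A \<Omega>. \<forall>y\<in>carrier (quotient_module H S). sup_dist \<Omega> g f < \<delta> \<longrightarrow>
      hnorm (quotient_module H S) (y \<ominus>\<^bsub>quotient_module H S\<^esub> x) < \<delta> \<longrightarrow>
      hnorm (quotient_module H S) (act (quotient_module H S) g y
        \<ominus>\<^bsub>quotient_module H S\<^esub> act (quotient_module H S) f x) < e"
    using \<delta> f x by (intro exI[of _ \<delta>]) (simp add: quotient_minus P_in_Q Q_carrier)
qed (simp_all add: Q_carrier P_in_Q act_add_left act_add_right act_mult act_one act_const
      P_add P_id Q_smult P_act_P)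

end

text \<open>Every axiom is an identity or an estimate between elements of the form \<open>U x\<close>, so it can be
  pulled back through \<open>U\<close>.  The zero of \<open>K\<close> is a field of the record and must be matched separately.\<close>

theorem hilbert_module_transport:
  fixes H :: "('m::finite cvec \<Rightarrow> complex, 'v) hilb" and K :: "('m cvec \<Rightarrow> complex, 'w) hilb"
  assumes H: "hilbert_module \<Omega> H" and U: "unitary_between H K U" and zero: "U \<zero>\<^bsub>H\<^esub> = \<zero>\<^bsub>K\<^esub>"
    and act: "\<And>f x. f \<in> algebra_A \<Omega> \<Longrightarrow> x \<in> carrier H \<Longrightarrow> U (act H f x) = act K f (U x)"
  shows "hilbert_module \<Omega> K"
proof -
  interpret H: hilb_module H \<Omega> by (rule hilb_moduleI[OF H])
  have K: "carrier K = U ` carrier H" and inj: "inj_on U (carrier H)"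
    using U by (auto simp: unitary_between_def bij_betw_def)
  have add: "U x \<oplus>\<^bsub>K\<^esub> U y = U (x \<oplus>\<^bsub>H\<^esub> y)" if "x \<in> carrier H" "y \<in> carrier H" for x y
    using U that by (simp add: unitary_between_def)
  have smult: "c \<odot>\<^bsub>K\<^esub> U x = U (c \<odot>\<^bsub>H\<^esub> x)" if "x \<in> carrier H" for c x
    using U that by (simp add: unitary_between_def)
  have ip: "ip K (U x) (U y) = ip H x y" if "x \<in> carrier H" "y \<in> carrier H" for x y
    using U that by (simp add: unitary_between_def)
  have inner: "inner_product_space K"
  proof (rule inner_product_spaceI)
    show "abelian_group K"
    proof (rule abelian_groupI)
      fix y assume "y \<in> carrier K"
      then obtain x where x: "x \<in> carrier H" "y = U x" by (auto simp: K)
      have "(-1) \<odot>\<^bsub>H\<^esub> x \<oplus>\<^bsub>H\<^esub> x = \<zero>\<^bsub>H\<^esub>"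
        by (rule H.ip_eqI) (use x in simp_all)
      then show "\<exists>w\<in>carrier K. w \<oplus>\<^bsub>K\<^esub> y = \<zero>\<^bsub>K\<^esub>"
        using x by (intro bexI[of _ "U ((-1) \<odot>\<^bsub>H\<^esub> x)"]) (simp_all add: K add zero[symmetric])
    qed (auto simp: K add zero[symmetric] H.M.a_assoc H.M.a_comm H.M.a_lcomm)
    show "cring complex_ring" by (rule H.cring_complex_ring)
  next
    fix a b y assume "y \<in> carrier K"
    then obtain x where x: "x \<in> carrier H" "y = U x" by (auto simp: K)
    show "(a + b) \<odot>\<^bsub>K\<^esub> y = a \<odot>\<^bsub>K\<^esub> y \<oplus>\<^bsub>K\<^esub> b \<odot>\<^bsub>K\<^esub> y"
      using H.smult_l_distr[of a b x] x by (simp add: smult add)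
    show "(a * b) \<odot>\<^bsub>K\<^esub> y = a \<odot>\<^bsub>K\<^esub> (b \<odot>\<^bsub>K\<^esub> y)"
      using H.smult_assoc1[of a b x] x by (simp add: smult)
    show "1 \<odot>\<^bsub>K\<^esub> y = y"
      using H.smult_one[of x] x by (simp add: smult)
  next
    fix y assume "y \<in> carrier K" "ip K y y = 0"
    then show "y = \<zero>\<^bsub>K\<^esub>" by (auto simp: K ip zero[symmetric] dest: H.ip_self_eq_0)
  qed (auto simp: K add smult ip H.smult_r_distr H.Re_ip_self_nonneg intro: H.ip_sym)
  interpret K: ip_space K by unfold_locales (rule inner)
  have minus: "U x \<ominus>\<^bsub>K\<^esub> U y = U (x \<ominus>\<^bsub>H\<^esub> y)" if "x \<in> carrier H" "y \<in> carrier H" for x y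
    using that by (simp add: K.minus_via_smult K H.minus_via_smult add smult)
  have norm: "hnorm K (U x) = hnorm H x" if "x \<in> carrier H" for x
    using that by (simp add: hnorm_def ip)
  have "hilbert_space K"
  proof (rule hilbert_spaceI[OF inner])
    fix Y :: "nat \<Rightarrow> 'w"
    assume "\<And>n. Y n \<in> carrier K"
    then have "\<forall>n. \<exists>x\<in>carrier H. Y n = U x" by (auto simp: K)
    then obtain X where X: "\<And>n. X n \<in> carrier H" and Y: "\<And>n. Y n = U (X n)" by metis
    assume "\<forall>e>0. \<exists>N. \<forall>m\<ge>N. \<forall>n\<ge>N. hnorm K (Y m \<ominus>\<^bsub>K\<^esub> Y n) < e"
    then have "\<And>e. e > 0 \<Longrightarrow> \<exists>N. \<forall>m\<ge>N. \<forall>n\<ge>N. hnorm H (X m \<ominus>\<^bsub>H\<^esub> X n) < e"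
      by (simp add: X Y minus norm)
    then obtain x where x: "x \<in> carrier H" "(\<lambda>n. hnorm H (X n \<ominus>\<^bsub>H\<^esub> x)) \<longlonglongrightarrow> 0"
      using H.complete[of X] X by blast
    then show "\<exists>y\<in>carrier K. (\<lambda>n. hnorm K (Y n \<ominus>\<^bsub>K\<^esub> y)) \<longlonglongrightarrow> 0"
      by (intro bexI[of _ "U x"]) (simp_all add: K X Y minus norm)
  qed
  then show ?thesis
  proof (rule hilbert_moduleI[OF _ H.cring_ring_A])
    fix f y and e :: real
    assume f: "f \<in> algebra_A \<Omega>" and "y \<in> carrier K" and e: "e > 0"
    then obtain x where x: "x \<in> carrier H" "y = U x" by (auto simp: K)
    obtain \<delta> where "\<delta> > 0" "\<And>g y. g \<in> algebra_A \<Omega> \<Longrightarrow> y \<in> carrier H \<Longrightarrow>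
        sup_dist \<Omega> g f < \<delta> \<Longrightarrow> hnorm H (y \<ominus>\<^bsub>H\<^esub> x) < \<delta> \<Longrightarrow> hnorm H (act H g y \<ominus>\<^bsub>H\<^esub> act H f x) < e"
      using H.act_continuous[OF f x(1) e] by blast
    then show "\<exists>\<delta>>0. \<forall>g\<in>algebra_A \<Omega>. \<forall>w\<in>carrier K. sup_dist \<Omega> g f < \<delta> \<longrightarrow>
        hnorm K (w \<ominus>\<^bsub>K\<^esub> y) < \<delta> \<longrightarrow> hnorm K (act K g w \<ominus>\<^bsub>K\<^esub> act K f y) < e"
      using x f by (intro exI[of _ \<delta>]) (simp add: K minus norm act[symmetric])
  next
    fix f g y assume fg: "f \<in> algebra_A \<Omega>" "g \<in> algebra_A \<Omega>" and "y \<in> carrier K"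
    then obtain x where x: "x \<in> carrier H" "y = U x" by (auto simp: K)
    have "f \<oplus>\<^bsub>ring_A \<Omega>\<^esub> g \<in> algebra_A \<Omega>" "f \<otimes>\<^bsub>ring_A \<Omega>\<^esub> g \<in> algebra_A \<Omega>"
      using fg cring.cring_simprules(1,5)[OF H.cring_ring_A] by (simp_all add: H.carrier_ring_A)
    then show "act K (f \<oplus>\<^bsub>ring_A \<Omega>\<^esub> g) y = act K f y \<oplus>\<^bsub>K\<^esub> act K g y"
      and "act K (f \<otimes>\<^bsub>ring_A \<Omega>\<^esub> g) y = act K f (act K g y)"
      using x fg by (simp_all add: act[symmetric] add H.act_add_left H.act_mult)
  next
    fix y assume "y \<in> carrier K"
    then obtain x where x: "x \<in> carrier H" "y = U x" by (auto simp: K)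
    have "\<one>\<^bsub>ring_A \<Omega>\<^esub> \<in> algebra_A \<Omega>"
      using cring.cring_simprules(6)[OF H.cring_ring_A] by (simp add: H.carrier_ring_A)
    then show "act K \<one>\<^bsub>ring_A \<Omega>\<^esub> y = y"
      using x by (simp add: act[symmetric] H.act_one)
    fix c :: complex
    have "(\<lambda>z\<in>closure \<Omega>. c) \<in> algebra_A \<Omega>"
      by (rule const_in_algebra_A)
    then show "act K (\<lambda>z\<in>closure \<Omega>. c) y = c \<odot>\<^bsub>K\<^esub> y"
      using x by (simp add: act[symmetric] H.act_const smult)
  qed (auto simp: K act[symmetric] add H.act_add_right)
qed

section \<open>Iterated partial derivatives and the Leibniz rule\<close>

text \<open>Continuity together with complex differentiability in each coordinate.  This class contains
  the holomorphic functions and is closed under each partial derivative by one-variable arguments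
  alone; continuity serves to bound the function locally, as the Cauchy estimates require.\<close>

definition separately_holomorphic ::
  "'m::finite cvec set \<Rightarrow> ('m cvec \<Rightarrow> complex) \<Rightarrow> bool" where
  "separately_holomorphic \<Omega> f \<longleftrightarrow> continuous_on \<Omega> f \<and>
     (\<forall>z\<in>\<Omega>. \<forall>i. (\<lambda>t. f (z + t *s axis i 1)) field_differentiable (at 0))"

lemma norm_smult_axis [simp]: "norm (t *s axis i (1::complex)) = cmod t"
proof -
  have "norm (t *s axis i (1::complex)) = sqrt (\<Sum>j\<in>UNIV. if j = i then (cmod t)\<^sup>2 else 0)"
    unfolding norm_vec_def L2_set_def
    by (intro arg_cong[where f = sqrt] sum.cong) (auto simp: axis_def)
  then show ?thesis by simp
qed

lemma bounded_linear_smult_axis: "bounded_linear (\<lambda>t. t *s axis i (1::complex))"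
  by (rule bounded_linear_intro[where K = 1])
    (auto simp: vec_eq_iff algebra_simps norm_smult_axis)

lemma continuous_on_slice: "continuous_on T (\<lambda>t. z + t *s axis i (1::complex))"
  by (intro continuous_intros bounded_linear.continuous_on[OF bounded_linear_smult_axis])

lemma separately_holomorphic_slice:
  assumes f: "separately_holomorphic \<Omega> f"
    and T: "\<And>t. t \<in> T \<Longrightarrow> z + t *s axis i 1 \<in> \<Omega>"
  shows "(\<lambda>t. f (z + t *s axis i 1)) holomorphic_on T"
    and "continuous_on T (\<lambda>t. f (z + t *s axis i 1))"
proof -
  have "(\<lambda>t. f (z + t *s axis i 1)) field_differentiable (at t)" if t: "t \<in> T" for t
  proof -
    have "(\<lambda>s. f ((z + t *s axis i 1) + s *s axis i 1)) field_differentiable (at 0)"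
      using f T[OF t] unfolding separately_holomorphic_def by blast
    moreover have "(z + t *s axis i 1) + s *s axis i 1 = z + (s + t) *s axis i 1" for s
      by (simp add: vec_eq_iff algebra_simps)
    ultimately show ?thesis
      using DERIV_shift[of "\<lambda>t. f (z + t *s axis i 1)" _ 0 t]
      unfolding field_differentiable_def by auto
  qed
  then show "(\<lambda>t. f (z + t *s axis i 1)) holomorphic_on T"
    by (simp add: holomorphic_on_def field_differentiable_at_within)
  then show "continuous_on T (\<lambda>t. f (z + t *s axis i 1))"
    by (rule holomorphic_on_imp_continuous_on)
qed

lemma partial_has_derivative:
  assumes "separately_holomorphic \<Omega> f" "z \<in> \<Omega>"
  shows "((\<lambda>t. f (z + t *s axis i 1)) has_field_derivative partial i f z) (at 0)"
  using assms unfolding separately_holomorphic_def partial_def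
  by (auto intro: field_differentiable_derivI)

lemma holomorphic_several_imp_separately:
  assumes "holomorphic_several f \<Omega>"
  shows "separately_holomorphic \<Omega> f"
  unfolding separately_holomorphic_def
proof (intro conjI ballI allI)
  show "continuous_on \<Omega> f"
    using assms unfolding holomorphic_several_def
    by (meson continuous_at_imp_continuous_on has_derivative_continuous)
next
  fix z i assume "z \<in> \<Omega>"
  then obtain D where D: "(f has_derivative D) (at z)" "\<And>c v. D (c *s v) = c * D v"
    using assms unfolding holomorphic_several_def by blast
  have "((\<lambda>t. z + t *s axis i (1::complex)) has_derivative (\<lambda>t. t *s axis i 1)) (at 0)"
    by (rule derivative_eq_intros bounded_linear.has_derivative[OF bounded_linear_smult_axis]
        has_derivative_ident refl)+ simp
  moreover have "(f has_derivative D) (at (z + 0 *s axis i 1))"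
    using D by simp
  ultimately have "((\<lambda>t. f (z + t *s axis i 1)) has_derivative (\<lambda>t. D (t *s axis i 1))) (at 0)"
    by (rule has_derivative_compose)
  then have "((\<lambda>t. f (z + t *s axis i 1)) has_field_derivative D (axis i 1)) (at 0)"
    unfolding has_field_derivative_def D(2) by (simp add: mult_commute_abs)
  then show "(\<lambda>t. f (z + t *s axis i 1)) field_differentiable (at 0)"
    unfolding field_differentiable_def by blast
qed

text \<open>Taylor's formula of first order, with the second derivative on the disc of radius \<open>r / 2\<close>
  estimated by Cauchy's inequality on discs of radius \<open>r / 4\<close>: the constant is \<open>2! / (1 / 4)\<^sup>2 = 32\<close>.
  It depends on \<open>g\<close> only through the bound \<open>B\<close>, so the estimate is uniform over families.\<close>

lemma difference_quotient_error:
  assumes g: "g holomorphic_on ball 0 r" and B: "\<And>t. t \<in> ball 0 r \<Longrightarrow> cmod (g t) \<le> B"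
    and t: "t \<noteq> 0" "cmod t < r / 2"
  shows "cmod ((g t - g 0) / t - deriv g 0) \<le> 32 * B / r\<^sup>2 * cmod t"
proof -
  have r: "r > 0" using t norm_ge_zero[of t] by linarith
  have "cmod (g t - (\<Sum>i\<le>1. (deriv ^^ i) g 0 * (t - 0) ^ i / fact i))
      \<le> (32 * B / r\<^sup>2) * cmod (t - 0) ^ Suc 1 / fact 1"
  proof (rule complex_Taylor[of "ball 0 (r / 2)" 1 "\<lambda>i. (deriv ^^ i) g", simplified funpow_0])
    fix i x assume x: "x \<in> ball (0::complex) (r / 2)"
    have "(deriv ^^ i) g holomorphic_on ball 0 r"
      by (rule holomorphic_higher_deriv[OF g]) simp
    then have "(deriv ^^ i) g field_differentiable (at x)"
      using x r by (intro holomorphic_on_imp_differentiable_at[of _ "ball 0 r"]) auto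
    then show "((deriv ^^ i) g has_field_derivative (deriv ^^ Suc i) g x) (at x within ball 0 (r / 2))"
      by (simp add: field_differentiable_derivI has_field_derivative_at_within)
  next
    fix x assume x: "x \<in> ball (0::complex) (r / 2)"
    have sub: "cball x (r / 4) \<subseteq> ball 0 r"
    proof
      fix y assume "y \<in> cball x (r / 4)"
      then show "y \<in> ball 0 r"
        using x r norm_triangle_ineq[of x "y - x"] by (simp add: dist_norm norm_minus_commute)
    qed
    have "cmod ((deriv ^^ 2) g x) \<le> fact 2 * B / (r / 4) ^ 2"
    proof (rule Cauchy_inequality)
      show "g holomorphic_on ball x (r / 4)"
        by (rule holomorphic_on_subset[OF g]) (use sub in auto)
      show "continuous_on (cball x (r / 4)) g"
        by (rule continuous_on_subset[OF holomorphic_on_imp_continuous_on[OF g] sub])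
      show "cmod (g y) \<le> B" if "cmod (x - y) = r / 4" for y
        using that sub by (intro B) (auto simp: dist_norm)
    qed (use r in simp)
    then show "cmod ((deriv ^^ Suc 1) g x) \<le> 32 * B / r\<^sup>2"
      by (simp add: power2_eq_square numeral_2_eq_2)
  qed (use t r in auto)
  then have "cmod (g t - g 0 - deriv g 0 * t) \<le> 32 * B / r\<^sup>2 * (cmod t)\<^sup>2"
    by (simp add: algebra_simps power2_eq_square)
  moreover have "g t - g 0 - deriv g 0 * t = ((g t - g 0) / t - deriv g 0) * t"
    using t by (simp add: field_simps)
  ultimately have "cmod ((g t - g 0) / t - deriv g 0) * cmod t \<le> 32 * B / r\<^sup>2 * cmod t * cmod t"
    by (simp add: norm_mult power2_eq_square mult.assoc)
  then show ?thesis by (rule mult_right_le_imp_le) (use t in simp)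
qed

text \<open>On a compact ball \<open>f\<close> is bounded, and the error estimate for the difference quotients of
  the slices through \<open>z\<close> involves only this bound; hence the convergence is uniform in \<open>z\<close>.\<close>

lemma difference_quotients_uniform_limit:
  assumes \<Omega>: "open \<Omega>" and f: "separately_holomorphic \<Omega> f" and z0: "z0 \<in> \<Omega>"
  obtains \<rho> h where "\<rho> > 0" "cball z0 (2 * \<rho>) \<subseteq> \<Omega>" "\<And>n::nat. cmod (h n) \<le> \<rho>" "\<And>n. h n \<noteq> 0"
    "uniform_limit (cball z0 \<rho>) (\<lambda>n z. (f (z + h n *s axis i 1) - f z) / h n) (partial i f) sequentially"
proof -
  obtain R where R: "R > 0" "cball z0 R \<subseteq> \<Omega>"
    using \<Omega> z0 open_contains_cball by blast
  have "compact (f ` cball z0 R)"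
    using f R by (intro compact_continuous_image)
      (auto simp: separately_holomorphic_def intro: continuous_on_subset)
  then obtain B where B: "\<And>z. z \<in> cball z0 R \<Longrightarrow> cmod (f z) \<le> B"
    by (meson bounded_iff compact_imp_bounded image_eqI)
  define \<rho> where "\<rho> = R / 2"
  \<comment> \<open>The summand \<open>3\<close> keeps every step shorter than \<open>\<rho> / 2\<close>, as the error estimate demands.\<close>
  define h where "h n = complex_of_real (\<rho> / (real n + 3))" for n
  have \<rho>: "\<rho> > 0" using R by (simp add: \<rho>_def)
  have hn: "cmod (h n) = \<rho> / (real n + 3)" for n
    unfolding h_def norm_of_real using \<rho> by simp
  have h0: "h n \<noteq> 0" for n
    unfolding h_def using \<rho> by (simp del: of_real_divide of_real_add)
  have hs: "cmod (h n) < \<rho> / 2" for n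
    unfolding hn using \<rho> by (intro divide_strict_left_mono) auto
  have err: "cmod ((f (z + h n *s axis i 1) - f z) / h n - partial i f z)
      \<le> 32 * B / \<rho>\<^sup>2 * cmod (h n)" if z: "z \<in> cball z0 \<rho>" for z n
  proof -
    have inR: "z + t *s axis i 1 \<in> cball z0 R" if "t \<in> ball 0 \<rho>" for t
      using that z norm_triangle_ineq[of "z - z0" "t *s axis i 1"] norm_smult_axis[of t i]
      by (simp add: dist_norm norm_minus_commute \<rho>_def algebra_simps del: norm_smult_axis)
    define g where "g t = f (z + t *s axis i 1)" for t
    have "g holomorphic_on ball 0 \<rho>"
      unfolding g_def using inR R by (intro separately_holomorphic_slice[OF f]) auto
    moreover have "cmod (g t) \<le> B" if "t \<in> ball 0 \<rho>" for t
      unfolding g_def by (rule B[OF inR[OF that]])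
    ultimately have "cmod ((g (h n) - g 0) / h n - deriv g 0) \<le> 32 * B / \<rho>\<^sup>2 * cmod (h n)"
      using h0 hs by (rule difference_quotient_error)
    then show ?thesis unfolding partial_def g_def[abs_def] by simp
  qed
  have "uniform_limit (cball z0 \<rho>) (\<lambda>n z. (f (z + h n *s axis i 1) - f z) / h n) (partial i f) sequentially"
  proof (rule uniform_limitI)
    fix e :: real assume e: "e > 0"
    have "(\<lambda>n. 32 * B / \<rho>\<^sup>2 * cmod (h n)) \<longlonglongrightarrow> 32 * B / \<rho>\<^sup>2 * 0"
    proof (intro tendsto_mult tendsto_const)
      have "(\<lambda>n. \<rho> * inverse (real (n + 3))) \<longlonglongrightarrow> \<rho> * 0"
        by (intro tendsto_mult tendsto_const LIMSEQ_ignore_initial_segment[OF lim_inverse_n])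
      then show "(\<lambda>n. cmod (h n)) \<longlonglongrightarrow> 0" by (simp add: hn divide_inverse)
    qed
    then have "\<forall>\<^sub>F n in sequentially. 32 * B / \<rho>\<^sup>2 * cmod (h n) < e"
      using e by (intro order_tendstoD(2)) auto
    then show "\<forall>\<^sub>F n in sequentially. \<forall>z\<in>cball z0 \<rho>.
        dist ((f (z + h n *s axis i 1) - f z) / h n) (partial i f z) < e"
      by (rule eventually_mono) (use err in \<open>unfold dist_norm, blast intro: le_less_trans\<close>)
  qed
  moreover have "cmod (h n) \<le> \<rho>" for n using hs[of n] \<rho> by linarith
  ultimately show ?thesis
    using \<rho> R h0 by (intro that[of \<rho> h]) (simp_all add: \<rho>_def)
qed

text \<open>The difference quotients are continuous and separately holomorphic, and both properties
  survive the locally uniform limit, the second by the Weierstrass convergence theorem applied to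
  each one-variable slice.\<close>

lemma separately_holomorphic_partial:
  assumes \<Omega>: "open \<Omega>" and f: "separately_holomorphic \<Omega> f"
  shows "separately_holomorphic \<Omega> (partial i f)"
proof -
  have "isCont (partial i f) z0 \<and>
      (\<lambda>t. partial i f (z0 + t *s axis j 1)) field_differentiable (at 0)" if z0: "z0 \<in> \<Omega>" for z0 j
  proof -
    obtain \<rho> h where \<rho>: "\<rho> > 0" "cball z0 (2 * \<rho>) \<subseteq> \<Omega>" and h: "\<And>n. cmod (h n) \<le> \<rho>" "\<And>n. h n \<noteq> 0"
      and lim: "uniform_limit (cball z0 \<rho>) (\<lambda>n z. (f (z + h n *s axis i 1) - f z) / h n)
        (partial i f) sequentially"
      using difference_quotients_uniform_limit[OF \<Omega> f z0] by blast
    have in\<Omega>: "z + h n *s axis i 1 \<in> \<Omega>" "z \<in> \<Omega>" if "z \<in> cball z0 \<rho>" for z n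
    proof -
      have "dist z0 (z + h n *s axis i 1) \<le> dist z0 z + cmod (h n)"
        using norm_triangle_ineq4[of "z0 - z" "h n *s axis i 1"]
        by (simp add: dist_norm algebra_simps)
      then have "z + h n *s axis i 1 \<in> cball z0 (2 * \<rho>)"
        using that h(1)[of n] by simp
      then show "z + h n *s axis i 1 \<in> \<Omega>" using \<rho> by blast
      show "z \<in> \<Omega>" using that \<rho> by auto
    qed
    have cf: "continuous_on \<Omega> f" using f by (simp add: separately_holomorphic_def)
    have "continuous_on (cball z0 \<rho>) (\<lambda>z. (f (z + h n *s axis i 1) - f z) / h n)" for n
      using in\<Omega> h by (intro continuous_intros continuous_on_compose2[OF cf]) auto
    then have "continuous_on (cball z0 \<rho>) (partial i f)"
      by (intro uniform_limit_theorem[OF _ lim]) auto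
    then have cont: "isCont (partial i f) z0"
      using \<rho> by (intro continuous_on_interior) auto
    have ball: "z0 + t *s axis j 1 \<in> cball z0 \<rho>" if "t \<in> cball 0 \<rho>" for t
      using that by (simp add: dist_norm)
    have "uniform_limit (cball 0 \<rho>)
        (\<lambda>n t. (f ((z0 + t *s axis j 1) + h n *s axis i 1) - f (z0 + t *s axis j 1)) / h n)
        (\<lambda>t. partial i f (z0 + t *s axis j 1)) sequentially"
      by (rule uniform_limit_compose'[OF lim]) (use ball in blast)
    moreover have "(\<lambda>t. (f ((z0 + t *s axis j 1) + h n *s axis i 1) - f (z0 + t *s axis j 1)) / h n)
        holomorphic_on cball 0 \<rho>" for n
    proof -
      have comm: "(z0 + t *s axis j 1) + h n *s axis i 1 = (z0 + h n *s axis i 1) + t *s axis j 1" for t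
        by (simp add: algebra_simps)
      have "(\<lambda>t. f ((z0 + h n *s axis i 1) + t *s axis j 1)) holomorphic_on cball 0 \<rho>"
        by (rule separately_holomorphic_slice[OF f]) (use in\<Omega>(1)[OF ball] in \<open>simp add: comm[symmetric]\<close>)
      moreover have "(\<lambda>t. f (z0 + t *s axis j 1)) holomorphic_on cball 0 \<rho>"
        by (rule separately_holomorphic_slice[OF f]) (use in\<Omega>(2)[OF ball] in auto)
      ultimately show ?thesis
        unfolding comm using h by (intro holomorphic_intros) auto
    qed
    ultimately have "(\<lambda>t. partial i f (z0 + t *s axis j 1)) holomorphic_on ball 0 \<rho>"
      by (elim holomorphic_uniform_limit[rotated])
        (auto intro!: always_eventually holomorphic_on_imp_continuous_on
          intro: holomorphic_on_subset[OF _ ball_subset_cball])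
    then have "(\<lambda>t. partial i f (z0 + t *s axis j 1)) field_differentiable (at 0)"
      using \<rho> by (intro holomorphic_on_imp_differentiable_at) auto
    with cont show ?thesis by blast
  qed
  then show ?thesis
    unfolding separately_holomorphic_def by (blast intro: continuous_at_imp_continuous_on)
qed

lemma partial_eqI:
  assumes "((\<lambda>t. f (z + t *s axis i 1)) has_field_derivative D) (at 0)"
  shows "partial i f z = D"
  unfolding partial_def by (rule DERIV_imp_deriv[OF assms])

lemma separately_holomorphic_mult:
  assumes "separately_holomorphic \<Omega> f" "separately_holomorphic \<Omega> g"
  shows "separately_holomorphic \<Omega> (\<lambda>z. f z * g z)"
  using assms unfolding separately_holomorphic_def
  by (auto intro!: continuous_intros field_differentiable_mult)

lemma separately_holomorphic_add:
  assumes "separately_holomorphic \<Omega> f" "separately_holomorphic \<Omega> g"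
  shows "separately_holomorphic \<Omega> (\<lambda>z. f z + g z)"
  using assms unfolding separately_holomorphic_def
  by (auto intro!: continuous_intros field_differentiable_add)

lemma separately_holomorphic_const: "separately_holomorphic \<Omega> (\<lambda>z. c)"
  unfolding separately_holomorphic_def by auto

lemma separately_holomorphic_sum:
  "(\<And>a. a \<in> A \<Longrightarrow> separately_holomorphic \<Omega> (F a)) \<Longrightarrow>
    separately_holomorphic \<Omega> (\<lambda>z. \<Sum>a\<in>A. F a z)"
  by (induction A rule: infinite_finite_induct)
    (auto intro: separately_holomorphic_const separately_holomorphic_add)

lemma partial_add:
  assumes "separately_holomorphic \<Omega> f" "separately_holomorphic \<Omega> g" "z \<in> \<Omega>"
  shows "partial i (\<lambda>w. f w + g w) z = partial i f z + partial i g z"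
  by (rule partial_eqI)
    (intro DERIV_add partial_has_derivative[OF assms(1,3)] partial_has_derivative[OF assms(2,3)])

lemma partial_mult:
  assumes "separately_holomorphic \<Omega> f" "separately_holomorphic \<Omega> g" "z \<in> \<Omega>"
  shows "partial i (\<lambda>w. f w * g w) z = partial i f z * g z + f z * partial i g z"
  using DERIV_mult[OF partial_has_derivative[OF assms(1,3)] partial_has_derivative[OF assms(2,3)]]
  by (intro partial_eqI) (simp add: algebra_simps)

lemma partial_const: "partial i (\<lambda>w. c) z = 0"
  by (rule partial_eqI) simp

lemma partial_cong:
  assumes \<Omega>: "open \<Omega>" and eq: "\<And>w. w \<in> \<Omega> \<Longrightarrow> f w = g w" and z: "z \<in> \<Omega>"
  shows "partial i f z = partial i g z"
proof -
  have "open ((\<lambda>t. z + t *s axis i (1::complex)) -` \<Omega>)"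
    using \<Omega> by (intro open_vimage continuous_on_slice)
  then have "\<forall>\<^sub>F t in nhds 0. z + t *s axis i 1 \<in> \<Omega>"
    using z by (auto dest: eventually_nhds_in_open[where x = 0])
  then have "\<forall>\<^sub>F t in nhds 0. f (z + t *s axis i 1) = g (z + t *s axis i 1)"
    by (rule eventually_mono) (rule eq)
  then show ?thesis unfolding partial_def by (intro deriv_cong_ev) auto
qed


lemma separately_holomorphic_cong:
  assumes \<Omega>: "open \<Omega>" and f: "separately_holomorphic \<Omega> f" and eq: "\<And>w. w \<in> \<Omega> \<Longrightarrow> f w = g w"
  shows "separately_holomorphic \<Omega> g"
  unfolding separately_holomorphic_def
proof (intro conjI ballI allI)
  show "continuous_on \<Omega> g"
    using f eq unfolding separately_holomorphic_def by (metis continuous_on_cong)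
next
  fix z i assume z: "z \<in> \<Omega>"
  let ?T = "(\<lambda>t. z + t *s axis i (1::complex)) -` \<Omega>"
  have "open ?T" using \<Omega> by (intro open_vimage continuous_on_slice)
  moreover have "0 \<in> ?T" using z by simp
  moreover have "(\<lambda>t. f (z + t *s axis i 1)) holomorphic_on ?T"
    by (rule separately_holomorphic_slice[OF f]) simp
  then have "(\<lambda>t. g (z + t *s axis i 1)) holomorphic_on ?T"
    by (rule holomorphic_transform) (simp add: eq)
  ultimately show "(\<lambda>t. g (z + t *s axis i 1)) field_differentiable (at 0)"
    by (auto intro: holomorphic_on_imp_differentiable_at)
qed

lemma separately_holomorphic_funpow_partial:
  assumes "open \<Omega>" "separately_holomorphic \<Omega> f"
  shows "separately_holomorphic \<Omega> ((partial i ^^ n) f)"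
  using assms by (induction n) (auto intro: separately_holomorphic_partial)

lemma funpow_partial_cong:
  assumes \<Omega>: "open \<Omega>" and eq: "\<And>w. w \<in> \<Omega> \<Longrightarrow> f w = g w"
  shows "z \<in> \<Omega> \<Longrightarrow> (partial i ^^ n) f z = (partial i ^^ n) g z"
proof (induction n arbitrary: z)
  case (Suc n)
  show ?case
    unfolding funpow.simps o_apply by (rule partial_cong[OF \<Omega> Suc.IH Suc.prems])
qed (simp add: eq)

lemma funpow_partial_add:
  assumes \<Omega>: "open \<Omega>" and f: "separately_holomorphic \<Omega> f" and g: "separately_holomorphic \<Omega> g"
  shows "z \<in> \<Omega> \<Longrightarrow> (partial i ^^ n) (\<lambda>w. f w + g w) z = (partial i ^^ n) f z + (partial i ^^ n) g z"
proof (induction n arbitrary: z)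
  case (Suc n)
  have "(partial i ^^ Suc n) (\<lambda>w. f w + g w) z
      = partial i (\<lambda>w. (partial i ^^ n) f w + (partial i ^^ n) g w) z"
    unfolding funpow.simps o_apply by (rule partial_cong[OF \<Omega> Suc.IH Suc.prems])
  then show ?case
    using Suc.prems \<Omega> f g by (simp add: partial_add[of \<Omega>] separately_holomorphic_funpow_partial)
qed simp

lemma funpow_partial_cmult:
  assumes \<Omega>: "open \<Omega>" and f: "separately_holomorphic \<Omega> f"
  shows "z \<in> \<Omega> \<Longrightarrow> (partial i ^^ n) (\<lambda>w. c * f w) z = c * (partial i ^^ n) f z"
proof (induction n arbitrary: z)
  case (Suc n)
  have "(partial i ^^ Suc n) (\<lambda>w. c * f w) z = partial i (\<lambda>w. c * (partial i ^^ n) f w) z"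
    unfolding funpow.simps o_apply by (rule partial_cong[OF \<Omega> Suc.IH Suc.prems])
  then show ?case
    using Suc.prems \<Omega> f
    by (simp add: partial_mult[of \<Omega>] partial_const separately_holomorphic_const
        separately_holomorphic_funpow_partial)
qed simp

lemma funpow_partial_zero: "(partial i ^^ n) (\<lambda>w. 0) = (\<lambda>w. 0)"
proof (induction n)
  case (Suc n)
  have "partial i (\<lambda>w. 0) = (\<lambda>w. 0)" by (rule ext) (rule partial_const)
  with Suc show ?case by simp
qed simp

lemma funpow_partial_sum:
  assumes \<Omega>: "open \<Omega>" and F: "\<And>a. a \<in> A \<Longrightarrow> separately_holomorphic \<Omega> (F a)" and z: "z \<in> \<Omega>"
  shows "(partial i ^^ n) (\<lambda>w. \<Sum>a\<in>A. F a w) z = (\<Sum>a\<in>A. (partial i ^^ n) (F a) z)"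
  using F
proof (induction A rule: infinite_finite_induct)
  case (insert a A)
  then show ?case
    using z by (simp add: funpow_partial_add[OF \<Omega>] separately_holomorphic_sum)
qed (simp_all add: funpow_partial_zero)

text \<open>Pascal's rule, in the form needed to pass from order \<open>n\<close> to order \<open>Suc n\<close> in the Leibniz
  formula.\<close>

lemma binomial_convolution_step:
  fixes a b :: "nat \<Rightarrow> 'a::comm_ring_1"
  shows "(\<Sum>j\<le>n. of_nat (n choose j) * (a (Suc (n - j)) * b j))
      + (\<Sum>j\<le>n. of_nat (n choose j) * (a (n - j) * b (Suc j)))
    = (\<Sum>j\<le>Suc n. of_nat (Suc n choose j) * (a (Suc n - j) * b j))"
proof -
  have "(\<Sum>j\<le>n. of_nat (n choose j) * (a (Suc (n - j)) * b j))
      = (\<Sum>j\<le>Suc n. of_nat (n choose j) * (a (Suc n - j) * b j))"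
    by (simp add: Suc_diff_le binomial_eq_0)
  also have "\<dots> = a (Suc n) * b 0
      + (\<Sum>j\<le>n. of_nat (n choose Suc j) * (a (n - j) * b (Suc j)))"
    by (subst sum.atMost_Suc_shift) simp
  finally show ?thesis
    by (subst sum.atMost_Suc_shift) (simp add: sum.distrib algebra_simps)
qed

lemma funpow_partial_mult:
  assumes \<Omega>: "open \<Omega>"
  shows "separately_holomorphic \<Omega> f \<Longrightarrow> separately_holomorphic \<Omega> g \<Longrightarrow> z \<in> \<Omega> \<Longrightarrow>
    (partial i ^^ n) (\<lambda>w. f w * g w) z
      = (\<Sum>j\<le>n. of_nat (n choose j) * ((partial i ^^ (n - j)) f z * (partial i ^^ j) g z))"
proof (induction n arbitrary: f g)
  case (Suc n)
  note f = Suc.prems(1) and g = Suc.prems(2) and z = Suc.prems(3)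
  have f': "separately_holomorphic \<Omega> (partial i f)" and g': "separately_holomorphic \<Omega> (partial i g)"
    using f g by (auto intro: separately_holomorphic_partial[OF \<Omega>])
  have "(partial i ^^ Suc n) (\<lambda>w. f w * g w) z
      = (partial i ^^ n) (\<lambda>w. partial i f w * g w + f w * partial i g w) z"
    unfolding funpow_Suc_right o_def
    using z by (intro funpow_partial_cong[OF \<Omega>]) (auto simp: partial_mult[OF f g])
  also have "\<dots> = (\<Sum>j\<le>n. of_nat (n choose j) * ((partial i ^^ Suc (n - j)) f z * (partial i ^^ j) g z))
      + (\<Sum>j\<le>n. of_nat (n choose j) * ((partial i ^^ (n - j)) f z * (partial i ^^ Suc j) g z))"
    using z by (subst funpow_partial_add[OF \<Omega>])
      (auto simp: Suc.IH f g f' g' separately_holomorphic_mult funpow_Suc_right simp del: funpow.simps)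
  finally show ?case
    using binomial_convolution_step[of n "\<lambda>j. (partial i ^^ j) f z" "\<lambda>j. (partial i ^^ j) g z"]
    by (simp only:)
qed simp

text \<open>The derivatives defining jets, for an arbitrary list of variables, so that one can argue by
  induction over the list.\<close>

definition iterated_partial :: "'m list \<Rightarrow> ('m \<Rightarrow> nat) \<Rightarrow> ('m::finite cvec \<Rightarrow> complex) \<Rightarrow> 'm cvec \<Rightarrow> complex"
  where "iterated_partial L \<alpha> f = foldr (\<lambda>i. partial i ^^ \<alpha> i) L f"

lemma iterated_partial_simps [simp]:
  "iterated_partial [] \<alpha> f = f"
  "iterated_partial (i # L) \<alpha> f = (partial i ^^ \<alpha> i) (iterated_partial L \<alpha> f)"
  by (simp_all add: iterated_partial_def)

lemma multi_partial_eq: "multi_partial d \<alpha> = iterated_partial (sorted_list_of_set (first_vars d)) \<alpha>"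
  by (simp add: multi_partial_def iterated_partial_def fun_eq_iff)

lemma separately_holomorphic_iterated_partial:
  assumes "open \<Omega>" "separately_holomorphic \<Omega> f"
  shows "separately_holomorphic \<Omega> (iterated_partial L \<alpha> f)"
  using assms by (induction L) (auto intro: separately_holomorphic_funpow_partial)

lemma iterated_partial_cong:
  assumes \<Omega>: "open \<Omega>" and eq: "\<And>w. w \<in> \<Omega> \<Longrightarrow> f w = g w"
  shows "z \<in> \<Omega> \<Longrightarrow> iterated_partial L \<alpha> f z = iterated_partial L \<alpha> g z"
proof (induction L arbitrary: z)
  case (Cons i L)
  show ?case
    unfolding iterated_partial_simps by (rule funpow_partial_cong[OF \<Omega> Cons.IH Cons.prems])
qed (simp add: eq)

lemma iterated_partial_index_cong:
  "(\<And>i. i \<in> set L \<Longrightarrow> \<alpha> i = \<beta> i) \<Longrightarrow> iterated_partial L \<alpha> f = iterated_partial L \<beta> f"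
  by (induction L) auto

lemma iterated_partial_zero_index: "iterated_partial L (\<lambda>_. 0) f = f"
  by (induction L) auto

text \<open>The multi-indices over which the Leibniz formula sums; the support condition makes the set
  the right one when only the variables in \<open>I\<close> are differentiated.\<close>

definition subindices :: "'m set \<Rightarrow> ('m \<Rightarrow> nat) \<Rightarrow> ('m \<Rightarrow> nat) set" where
  "subindices I \<alpha> = {\<beta>. \<beta> \<le> \<alpha> \<and> (\<forall>i. i \<notin> I \<longrightarrow> \<beta> i = 0)}"

text \<open>Differentiate the formula for \<open>L\<close> term by term in one more variable \<open>i\<close>.  A summand \<open>\<beta>\<close> of the
  old formula and an order \<open>j \<le> \<alpha> i\<close> of the one-variable formula combine to the multi-index
  \<open>\<beta>(i := j)\<close>, and \<open>\<beta> i = 0\<close> makes this a bijection.\<close>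

theorem Leibniz_iterated_partial:
  fixes f g :: "'m::finite cvec \<Rightarrow> complex"
  assumes \<Omega>: "open \<Omega>" and f: "separately_holomorphic \<Omega> f" and g: "separately_holomorphic \<Omega> g"
  shows "distinct L \<Longrightarrow> z \<in> \<Omega> \<Longrightarrow> iterated_partial L \<alpha> (\<lambda>w. f w * g w) z
    = (\<Sum>\<beta>\<in>subindices (set L) \<alpha>. of_nat (\<Prod>i\<in>set L. \<alpha> i choose \<beta> i)
        * (iterated_partial L (\<lambda>i. \<alpha> i - \<beta> i) f z * iterated_partial L \<beta> g z))"
proof (induction L arbitrary: z)
  case Nil
  have "subindices {} \<alpha> = {\<lambda>_. 0}" by (auto simp: subindices_def le_fun_def)
  then show ?case by simp
next
  case (Cons i L)
  have i: "i \<notin> set L" and L: "distinct L" and z: "z \<in> \<Omega>" using Cons.prems by auto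
  let ?B = "subindices (set L) \<alpha>"
  let ?c = "\<lambda>\<beta>. of_nat (\<Prod>i\<in>set L. \<alpha> i choose \<beta> i) :: complex"
  let ?F = "\<lambda>\<beta>. iterated_partial L (\<lambda>i. \<alpha> i - \<beta> i) f"
  let ?G = "\<lambda>\<beta>. iterated_partial L \<beta> g"
  have hF: "separately_holomorphic \<Omega> (?F \<beta>)" and hG: "separately_holomorphic \<Omega> (?G \<beta>)" for \<beta>
    using f g by (auto intro: separately_holomorphic_iterated_partial[OF \<Omega>])
  have hFG: "separately_holomorphic \<Omega> (\<lambda>w. ?F \<beta> w * ?G \<beta> w)" for \<beta>
    by (rule separately_holomorphic_mult[OF hF hG])
  have "iterated_partial (i # L) \<alpha> (\<lambda>w. f w * g w) z
      = (partial i ^^ \<alpha> i) (\<lambda>w. \<Sum>\<beta>\<in>?B. ?c \<beta> * (?F \<beta> w * ?G \<beta> w)) z"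
    unfolding iterated_partial_simps by (rule funpow_partial_cong[OF \<Omega> Cons.IH[OF L] z])
  also have "\<dots> = (\<Sum>\<beta>\<in>?B. ?c \<beta> * (partial i ^^ \<alpha> i) (\<lambda>w. ?F \<beta> w * ?G \<beta> w) z)"
    by (subst funpow_partial_sum[OF \<Omega> _ z])
      (auto intro!: sum.cong funpow_partial_cmult[OF \<Omega> hFG z] separately_holomorphic_mult[OF _ hFG]
        separately_holomorphic_const)
  also have "\<dots> = (\<Sum>\<beta>\<in>?B. \<Sum>j\<le>\<alpha> i. ?c \<beta> * of_nat (\<alpha> i choose j)
      * ((partial i ^^ (\<alpha> i - j)) (?F \<beta>) z * (partial i ^^ j) (?G \<beta>) z))"
    by (simp add: funpow_partial_mult[OF \<Omega> hF hG z] sum_distrib_left mult.assoc)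
  also have "\<dots> = (\<Sum>(\<beta>, j)\<in>?B \<times> {..\<alpha> i}. ?c \<beta> * of_nat (\<alpha> i choose j)
      * ((partial i ^^ (\<alpha> i - j)) (?F \<beta>) z * (partial i ^^ j) (?G \<beta>) z))"
    by (rule sum.cartesian_product)
  also have "\<dots> = (\<Sum>\<beta>\<in>subindices (set (i # L)) \<alpha>. of_nat (\<Prod>i\<in>set (i # L). \<alpha> i choose \<beta> i)
        * (iterated_partial (i # L) (\<lambda>i. \<alpha> i - \<beta> i) f z * iterated_partial (i # L) \<beta> g z))"
  proof (rule sum.reindex_bij_witness[where i = "\<lambda>\<beta>. (\<beta>(i := 0), \<beta> i)" and j = "\<lambda>(\<beta>, j). \<beta>(i := j)"])
    fix p assume "p \<in> ?B \<times> {..\<alpha> i}"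
    then obtain \<beta> j where p: "p = (\<beta>, j)" "\<beta> \<in> ?B" "j \<le> \<alpha> i" by auto
    have \<beta>i: "\<beta> i = 0" using p i by (simp add: subindices_def)
    show "(\<lambda>\<beta>. (\<beta>(i := 0), \<beta> i)) (case p of (\<beta>, j) \<Rightarrow> \<beta>(i := j)) = p"
      using p \<beta>i by (auto simp: fun_eq_iff)
    show "(case p of (\<beta>, j) \<Rightarrow> \<beta>(i := j)) \<in> subindices (set (i # L)) \<alpha>"
      using p by (auto simp: subindices_def le_fun_def)
    have "(\<Prod>l\<in>set L. \<alpha> l choose (\<beta>(i := j)) l) = (\<Prod>l\<in>set L. \<alpha> l choose \<beta> l)"
      using i by (intro prod.cong) auto
    moreover have "iterated_partial L (\<lambda>l. \<alpha> l - (\<beta>(i := j)) l) f = ?F \<beta>"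
      and "iterated_partial L (\<beta>(i := j)) g = ?G \<beta>"
      using i by (auto intro!: iterated_partial_index_cong)
    ultimately show "of_nat (\<Prod>l\<in>set (i # L). \<alpha> l choose (case p of (\<beta>, j) \<Rightarrow> \<beta>(i := j)) l)
        * (iterated_partial (i # L) (\<lambda>l. \<alpha> l - (case p of (\<beta>, j) \<Rightarrow> \<beta>(i := j)) l) f z
          * iterated_partial (i # L) (case p of (\<beta>, j) \<Rightarrow> \<beta>(i := j)) g z)
      = (case p of (\<beta>, j) \<Rightarrow> ?c \<beta> * of_nat (\<alpha> i choose j)
      * ((partial i ^^ (\<alpha> i - j)) (?F \<beta>) z * (partial i ^^ j) (?G \<beta>) z))"
      using p(1) i fun_upd_same[of \<beta> i j] by (simp add: mult.commute mult.left_commute del: fun_upd_apply)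
  next
    fix \<beta> assume \<beta>: "\<beta> \<in> subindices (set (i # L)) \<alpha>"
    show "(case (\<beta>(i := 0), \<beta> i) of (\<beta>, j) \<Rightarrow> \<beta>(i := j)) = \<beta>" by simp
    show "(\<beta>(i := 0), \<beta> i) \<in> ?B \<times> {..\<alpha> i}"
      using \<beta> by (auto simp: subindices_def le_fun_def)
  qed
  finally show ?case .
qed

section \<open>The quotient module as a module of jets\<close>

lemma finite_jet_indices: "finite (jet_indices d k :: ('m::{finite,linorder} \<Rightarrow> nat) set)"
proof (rule finite_subset)
  show "jet_indices d k \<subseteq> (PiE UNIV (\<lambda>_. {..<k}) :: ('m \<Rightarrow> nat) set)"
  proof
    fix \<alpha> :: "'m \<Rightarrow> nat" assume \<alpha>: "\<alpha> \<in> jet_indices d k"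
    have "\<alpha> i \<le> (\<Sum>i\<in>UNIV. \<alpha> i)" for i by (rule member_le_sum) auto
    then show "\<alpha> \<in> PiE UNIV (\<lambda>_. {..<k})"
      using \<alpha> by (auto simp: jet_indices_def intro: le_less_trans)
  qed
qed (simp add: finite_PiE)

lemma subindices_jet_indices:
  assumes \<alpha>: "\<alpha> \<in> jet_indices d k"
  shows "subindices (first_vars d) \<alpha> = {\<beta> \<in> jet_indices d k. \<beta> \<le> \<alpha>}"
proof -
  have "(\<Sum>i\<in>UNIV. \<beta> i) < k" if "\<beta> \<le> \<alpha>" for \<beta>
    using \<alpha> that sum_mono[of UNIV \<beta> \<alpha>] by (force simp: jet_indices_def le_fun_def)
  then show ?thesis by (auto simp: subindices_def jet_indices_def)
qed

text \<open>The Leibniz formula read as a matrix product: the row \<open>\<alpha>\<close> of \<open>\<J>(f)\<close> applied to the jet of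
  \<open>g\<close>.  Off the first \<open>d\<close> variables all binomial coefficients are \<open>1\<close>.\<close>

lemma Leibniz_multi_partial:
  assumes \<Omega>: "open \<Omega>" and f: "separately_holomorphic \<Omega> f" and g: "separately_holomorphic \<Omega> g"
    and z: "z \<in> \<Omega>" and \<alpha>: "\<alpha> \<in> jet_indices d k"
  shows "multi_partial d \<alpha> (\<lambda>w. f w * g w) z
    = (\<Sum>\<beta>\<in>jet_indices d k. jet_matrix d f z \<alpha> \<beta> * multi_partial d \<beta> g z)"
proof -
  have vars: "set (sorted_list_of_set (first_vars d)) = first_vars d"
    by (simp add: set_sorted_list_of_set)
  have choose: "(\<Prod>i\<in>first_vars d. \<alpha> i choose \<beta> i) = (\<Prod>i\<in>UNIV. \<alpha> i choose \<beta> i)" if "\<beta> \<le> \<alpha>" for \<beta>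
  proof (rule prod.mono_neutral_left)
    have "\<alpha> i = 0 \<and> \<beta> i = 0" if "i \<notin> first_vars d" for i
      using \<alpha> that le_funD[OF \<open>\<beta> \<le> \<alpha>\<close>, of i] by (simp add: jet_indices_def)
    then show "\<forall>i\<in>UNIV - first_vars d. \<alpha> i choose \<beta> i = 1" by simp
  qed simp_all
  have "multi_partial d \<alpha> (\<lambda>w. f w * g w) z
    = (\<Sum>\<beta>\<in>{\<beta> \<in> jet_indices d k. \<beta> \<le> \<alpha>}. of_nat (\<Prod>i\<in>first_vars d. \<alpha> i choose \<beta> i)
        * (multi_partial d (\<lambda>i. \<alpha> i - \<beta> i) f z * multi_partial d \<beta> g z))"
    unfolding multi_partial_eq
    by (subst Leibniz_iterated_partial[OF \<Omega> f g _ z]) (simp_all add: vars subindices_jet_indices[OF \<alpha>])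
  also have "\<dots> = (\<Sum>\<beta>\<in>{\<beta> \<in> jet_indices d k. \<beta> \<le> \<alpha>}. jet_matrix d f z \<alpha> \<beta> * multi_partial d \<beta> g z)"
    by (rule sum.cong) (simp_all add: jet_matrix_def choose mult.assoc del: of_nat_prod)
  also have "\<dots> = (\<Sum>\<beta>\<in>jet_indices d k. jet_matrix d f z \<alpha> \<beta> * multi_partial d \<beta> g z)"
    by (rule sum.mono_neutral_left) (auto simp: finite_jet_indices jet_matrix_def)
  finally show ?thesis .
qed

lemma zero_locus_subset: "z \<in> zero_locus d \<Omega> \<Longrightarrow> z \<in> \<Omega>"
  by (simp add: zero_locus_def)

locale jet_quotient =
  fixes \<Omega> :: "'m::{finite,linorder} cvec set"
    and M :: "('m cvec \<Rightarrow> complex, 'm cvec \<Rightarrow> complex ^ 'r) hilb" (structure)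
    and d k :: nat
  assumes open_\<Omega>: "open \<Omega>" and k: "1 \<le> k" and rk: "rk_hilbert_module \<Omega> M"
begin

sublocale hilb_module M \<Omega>
  by (rule hilb_moduleI) (use rk in \<open>simp add: rk_hilbert_module_def\<close>)

lemma M_apply:
  assumes "z \<in> \<Omega>"
  shows "(g \<oplus> h) z = g z + h z" "(c \<odot>\<^bsub>M\<^esub> h) z = c *s h z" "act M f h z = f z *s h z"
proof -
  obtain V p where "M = function_module \<Omega> V p"
    using rk by (auto simp: rk_hilbert_module_def)
  then show "(g \<oplus> h) z = g z + h z" "(c \<odot>\<^bsub>M\<^esub> h) z = c *s h z" "act M f h z = f z *s h z"
    using assms by (simp_all add: function_module_def)
qed

lemma extensional_M: "h \<in> carrier M \<Longrightarrow> h \<in> extensional \<Omega>"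
  using rk by (simp add: rk_hilbert_module_def)

lemma holomorphic_M: "h \<in> carrier M \<Longrightarrow> separately_holomorphic \<Omega> (\<lambda>z. h z $ j)"
  using rk by (intro holomorphic_several_imp_separately) (simp add: rk_hilbert_module_def)

lemma bounded_evaluation:
  assumes z: "z \<in> \<Omega>"
  shows "bounded_functional (\<lambda>h. h z $ j)"
proof -
  obtain C where C: "\<And>h. h \<in> carrier M \<Longrightarrow> norm (h z) \<le> C * hnorm M h"
    using rk z unfolding rk_hilbert_module_def by (elim conjE) blast
  have "cmod (h z $ j) \<le> C * hnorm M h" if "h \<in> carrier M" for h
    using C[OF that] Finite_Cartesian_Product.norm_nth_le[of "h z" j] by linarith
  then show ?thesis
    unfolding bounded_functional_def using z by (auto simp: M_apply)
qed

text \<open>The step lengths \<open>t n\<close> are chosen independently of \<open>h\<close>, so that each difference quotient is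
  one functional on \<open>M\<close>, bounded because \<open>E\<close> is evaluated at two points of \<open>\<Omega>\<close>.\<close>

lemma bounded_functional_partial:
  assumes E: "\<And>z. z \<in> \<Omega> \<Longrightarrow> bounded_functional (\<lambda>h. E h z)"
    and hol: "\<And>h. h \<in> carrier M \<Longrightarrow> separately_holomorphic \<Omega> (E h)" and z: "z \<in> \<Omega>"
  shows "bounded_functional (\<lambda>h. partial i (E h) z)"
proof -
  obtain r where r: "r > 0" "cball z r \<subseteq> \<Omega>"
    using open_\<Omega> z open_contains_cball by blast
  define t where "t n = complex_of_real (r * inverse (real (Suc n)))" for n
  have t0: "t n \<noteq> 0" for n
    using r unfolding t_def of_real_eq_0_iff by simp
  have t_le: "cmod (t n) \<le> r" for n
  proof -
    have "r * inverse (real (Suc n)) \<le> r * 1"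
      using r by (intro mult_left_mono) (simp_all add: field_simps)
    then show ?thesis
      unfolding t_def norm_of_real using r by simp
  qed
  have t_lim: "t \<longlonglongrightarrow> 0"
    using tendsto_of_real[OF tendsto_mult_right_zero[OF LIMSEQ_inverse_real_of_nat, of r]]
    unfolding t_def[abs_def] by (simp only: of_real_0)
  have in\<Omega>: "z + t n *s axis i 1 \<in> \<Omega>" for n
    using r t_le[of n] by (auto simp: dist_norm intro!: subsetD[OF r(2)])
  show ?thesis
  proof (rule bounded_functional_limit)
    show "bounded_functional (\<lambda>h. (1 / t n) * (E h (z + t n *s axis i 1) - E h z))" for n
      by (intro bounded_functional_scale_diff E in\<Omega> z)
    fix h assume h: "h \<in> carrier M"
    have "((\<lambda>s. (E h (z + s *s axis i 1) - E h z) / s) \<longlongrightarrow> partial i (E h) z) (at 0)"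
      using partial_has_derivative[OF hol[OF h] z, of i] by (simp add: DERIV_def)
    moreover have "filterlim t (at 0) sequentially"
      using t_lim t0 by (simp add: filterlim_at)
    ultimately have "((\<lambda>s. (E h (z + s *s axis i 1) - E h z) / s) \<circ> t) \<longlonglongrightarrow> partial i (E h) z"
      unfolding o_def by (rule filterlim_compose)
    then show "(\<lambda>n. (1 / t n) * (E h (z + t n *s axis i 1) - E h z)) \<longlonglongrightarrow> partial i (E h) z"
      by (simp add: o_def)
  qed
qed

lemma bounded_functional_funpow_partial:
  assumes E: "\<And>z. z \<in> \<Omega> \<Longrightarrow> bounded_functional (\<lambda>h. E h z)"
    and hol: "\<And>h. h \<in> carrier M \<Longrightarrow> separately_holomorphic \<Omega> (E h)"
  shows "z \<in> \<Omega> \<Longrightarrow> bounded_functional (\<lambda>h. (partial i ^^ n) (E h) z)"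
proof (induction n arbitrary: z)
  case (Suc n)
  show ?case
    unfolding funpow.simps o_apply
    by (rule bounded_functional_partial)
      (use Suc hol in \<open>auto intro: separately_holomorphic_funpow_partial[OF open_\<Omega>]\<close>)
qed (simp add: E)

lemma bounded_functional_iterated_partial:
  "z \<in> \<Omega> \<Longrightarrow> bounded_functional (\<lambda>h. iterated_partial L \<alpha> (\<lambda>w. h w $ j) z)"
proof (induction L arbitrary: z)
  case (Cons i L)
  show ?case
    unfolding iterated_partial_simps
    by (rule bounded_functional_funpow_partial)
      (use Cons holomorphic_M in \<open>auto intro: separately_holomorphic_iterated_partial[OF open_\<Omega>]\<close>)
qed (simp add: bounded_evaluation)

abbreviation "A \<equiv> jet_indices d k :: ('m \<Rightarrow> nat) set"
abbreviation "Z \<equiv> zero_locus d \<Omega>"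

definition jet_coordinate where
  "jet_coordinate \<alpha> j z h = multi_partial d \<alpha> (\<lambda>w. h w $ j) z"

lemma bounded_functional_jet_coordinate:
  "z \<in> \<Omega> \<Longrightarrow> bounded_functional (jet_coordinate \<alpha> j z)"
  unfolding jet_coordinate_def[abs_def] multi_partial_eq by (rule bounded_functional_iterated_partial)

lemma jet_coordinate_linear:
  assumes "z \<in> \<Omega>" "g \<in> carrier M" "h \<in> carrier M"
  shows "jet_coordinate \<alpha> j z (g \<oplus> h) = jet_coordinate \<alpha> j z g + jet_coordinate \<alpha> j z h"
    and "jet_coordinate \<alpha> j z (c \<odot>\<^bsub>M\<^esub> h) = c * jet_coordinate \<alpha> j z h"
    and "jet_coordinate \<alpha> j z (g \<ominus> h) = jet_coordinate \<alpha> j z g - jet_coordinate \<alpha> j z h"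
proof -
  note T = bounded_functional_jet_coordinate[OF assms(1), of \<alpha> j]
  show "jet_coordinate \<alpha> j z (g \<oplus> h) = jet_coordinate \<alpha> j z g + jet_coordinate \<alpha> j z h"
    and "jet_coordinate \<alpha> j z (c \<odot>\<^bsub>M\<^esub> h) = c * jet_coordinate \<alpha> j z h"
    using T assms by (simp_all add: bounded_functional_def)
  show "jet_coordinate \<alpha> j z (g \<ominus> h) = jet_coordinate \<alpha> j z g - jet_coordinate \<alpha> j z h"
    using bounded_functional_minus[OF T] assms by blast
qed

lemma jet_coordinate_zero: "z \<in> \<Omega> \<Longrightarrow> jet_coordinate \<alpha> j z \<zero> = 0"
  using jet_coordinate_linear(3)[of z \<zero> \<zero>] by simp

text \<open>Instead of taking limits of the approximating functions, let \<open>f\<close> act on a constant unit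
  vector, which belongs to \<open>M\<close>: the result lies in \<open>M\<close>, so its components are holomorphic, and one of
  them is \<open>f\<close>.\<close>

lemma holomorphic_algebra_A:
  assumes f: "f \<in> algebra_A \<Omega>"
  shows "separately_holomorphic \<Omega> f"
proof -
  fix j :: 'r
  let ?q = "\<lambda>z :: 'm cvec. axis j (1::complex)"
  have "vector_polynomial ?q"
    unfolding vector_polynomial_def
    by (rule exI[of _ "{\<lambda>_. 0}"], rule exI[of _ "\<lambda>_. axis j 1"]) simp
  then have "restrict ?q \<Omega> \<in> carrier M"
    using rk by (simp add: rk_hilbert_module_def)
  then have "separately_holomorphic \<Omega> (\<lambda>z. act M f (restrict ?q \<Omega>) z $ j)"
    by (intro holomorphic_M act_closed f)
  then show ?thesis
    by (rule separately_holomorphic_cong[OF open_\<Omega>]) (simp add: M_apply)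
qed

lemma jet_coordinate_act:
  assumes f: "f \<in> algebra_A \<Omega>" and h: "h \<in> carrier M" and z: "z \<in> \<Omega>" and \<alpha>: "\<alpha> \<in> A"
  shows "jet_coordinate \<alpha> j z (act M f h) = (\<Sum>\<beta>\<in>A. jet_matrix d f z \<alpha> \<beta> * jet_coordinate \<beta> j z h)"
proof -
  have "jet_coordinate \<alpha> j z (act M f h) = multi_partial d \<alpha> (\<lambda>w. f w * h w $ j) z"
    unfolding jet_coordinate_def multi_partial_eq
    by (rule iterated_partial_cong[OF open_\<Omega> _ z]) (simp add: M_apply)
  then show ?thesis
    using Leibniz_multi_partial[OF open_\<Omega> holomorphic_algebra_A[OF f] holomorphic_M[OF h] z \<alpha>]
    by (simp add: jet_coordinate_def)
qed

abbreviation "M0 \<equiv> vanishing_submodule d k \<Omega> M"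

lemma M0_iff:
  "h \<in> M0 \<longleftrightarrow> h \<in> carrier M \<and> (\<forall>\<alpha>\<in>A. \<forall>j. \<forall>z\<in>Z. jet_coordinate \<alpha> j z h = 0)"
  by (simp add: vanishing_submodule_def jet_coordinate_def)

sublocale closed_submodule M \<Omega> M0
proof
  have "closed_subspace {h \<in> carrier M. \<forall>T\<in>(\<lambda>(\<alpha>, j, z). jet_coordinate \<alpha> j z) ` (A \<times> UNIV \<times> Z). T h = 0}"
    by (rule closed_subspace_kernels)
      (auto intro: bounded_functional_jet_coordinate simp: zero_locus_subset)
  also have "{h \<in> carrier M. \<forall>T\<in>(\<lambda>(\<alpha>, j, z). jet_coordinate \<alpha> j z) ` (A \<times> UNIV \<times> Z). T h = 0} = M0"
    by (auto simp: M0_iff)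
  finally show "closed_subspace M0" .
  show "act M f h \<in> M0" if "f \<in> algebra_A \<Omega>" "h \<in> M0" for f h
    using that by (auto simp: M0_iff jet_coordinate_act zero_locus_subset)
qed

abbreviation "JM \<equiv> jet_module d k \<Omega> M"
abbreviation "JMZ \<equiv> jet_module_restricted d k \<Omega> M"

definition jet_restriction where
  "jet_restriction h = restrict (jet_map d k \<Omega> h) Z"

lemma jet_restriction_eq:
  "jet_restriction h = (\<lambda>z\<in>Z. \<lambda>(\<alpha>, j)\<in>A \<times> UNIV. jet_coordinate \<alpha> j z h)"
  by (auto simp: jet_restriction_def jet_map_def jet_coordinate_def zero_locus_subset restrict_def fun_eq_iff)

lemma jet_restriction_apply:
  "z \<in> Z \<Longrightarrow> \<alpha> \<in> A \<Longrightarrow> jet_restriction h z (\<alpha>, j) = jet_coordinate \<alpha> j z h"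
  by (simp add: jet_restriction_eq)

lemma jet_function_eqI:
  assumes "u \<in> extensional Z" "v \<in> extensional Z"
    "\<And>z. z \<in> Z \<Longrightarrow> u z \<in> extensional (A \<times> UNIV)" "\<And>z. z \<in> Z \<Longrightarrow> v z \<in> extensional (A \<times> UNIV)"
    "\<And>z \<alpha> j. z \<in> Z \<Longrightarrow> \<alpha> \<in> A \<Longrightarrow> u z (\<alpha>, j) = v z (\<alpha>, j)"
  shows "u = v"
proof (rule extensionalityI[OF assms(1,2)])
  fix z assume z: "z \<in> Z"
  show "u z = v z"
    by (rule extensionalityI[OF assms(3,4)[OF z]]) (use assms(5) z in auto)
qed

lemma jet_restriction_extensional [simp]:
  "jet_restriction h \<in> extensional Z" "z \<in> Z \<Longrightarrow> jet_restriction h z \<in> extensional (A \<times> UNIV)"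
  by (simp_all add: jet_restriction_eq)

lemma jet_restriction_eq_iff:
  assumes "g \<in> carrier M" "h \<in> carrier M"
  shows "jet_restriction g = jet_restriction h \<longleftrightarrow> g \<ominus> h \<in> M0"
proof
  assume eq: "jet_restriction g = jet_restriction h"
  have "jet_coordinate \<alpha> j z g = jet_coordinate \<alpha> j z h" if "z \<in> Z" "\<alpha> \<in> A" for z \<alpha> j
    using jet_restriction_apply[OF that, of g j] jet_restriction_apply[OF that, of h j] eq by simp
  then show "g \<ominus> h \<in> M0"
    using assms by (simp add: M0_iff jet_coordinate_linear zero_locus_subset)
next
  assume "g \<ominus> h \<in> M0"
  then show "jet_restriction g = jet_restriction h"
    using assms by (intro jet_function_eqI)
      (auto simp: M0_iff jet_coordinate_linear zero_locus_subset jet_restriction_apply)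
qed

lemma JMZ_simps:
  "carrier JMZ = jet_restriction ` carrier M"
  "add JMZ = (\<lambda>u v. \<lambda>z\<in>Z. \<lambda>x\<in>A \<times> UNIV. u z x + v z x)"
  "smult JMZ = (\<lambda>c u. \<lambda>z\<in>Z. \<lambda>x\<in>A \<times> UNIV. c * u z x)"
  "zero JMZ = (\<lambda>z\<in>Z. \<lambda>x\<in>A \<times> UNIV. 0)"
  "act JMZ = (\<lambda>f u. \<lambda>z\<in>Z. jet_act d k f z (u z))"
  by (simp_all add: jet_module_restricted_def jet_module_def jet_function_module_def
      jet_restriction_def image_image)

lemma jet_restriction_add:
  assumes "g \<in> carrier M" "h \<in> carrier M"
  shows "jet_restriction (g \<oplus> h) = jet_restriction g \<oplus>\<^bsub>JMZ\<^esub> jet_restriction h"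
  unfolding JMZ_simps by (rule jet_function_eqI)
    (use assms in \<open>auto simp: jet_restriction_apply jet_coordinate_linear zero_locus_subset\<close>)

lemma jet_restriction_smult:
  assumes "h \<in> carrier M"
  shows "jet_restriction (c \<odot>\<^bsub>M\<^esub> h) = c \<odot>\<^bsub>JMZ\<^esub> jet_restriction h"
  unfolding JMZ_simps by (rule jet_function_eqI)
    (use assms in \<open>auto simp: jet_restriction_apply jet_coordinate_linear zero_locus_subset\<close>)

lemma jet_restriction_zero: "jet_restriction \<zero> = \<zero>\<^bsub>JMZ\<^esub>"
  unfolding JMZ_simps by (rule jet_function_eqI)
    (auto simp: jet_restriction_apply jet_coordinate_zero zero_locus_subset)

lemma jet_restriction_act:
  assumes f: "f \<in> algebra_A \<Omega>" and h: "h \<in> carrier M"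
  shows "jet_restriction (act M f h) = act JMZ f (jet_restriction h)"
  unfolding JMZ_simps
proof (rule jet_function_eqI)
  fix z \<alpha> j assume z: "z \<in> Z" and \<alpha>: "\<alpha> \<in> A"
  have "jet_act d k f z (jet_restriction h z) (\<alpha>, j)
      = (\<Sum>(\<beta>, l)\<in>A \<times> UNIV. jet_matrix d f z \<alpha> \<beta> * (if j = l then 1 else 0) * jet_restriction h z (\<beta>, l))"
    using \<alpha> by (simp add: jet_act_def)
  also have "\<dots> = (\<Sum>\<beta>\<in>A. \<Sum>l\<in>UNIV.
      jet_matrix d f z \<alpha> \<beta> * (if j = l then 1 else 0) * jet_restriction h z (\<beta>, l))"
    by (rule sum.cartesian_product[symmetric])
  also have "\<dots> = (\<Sum>\<beta>\<in>A. jet_matrix d f z \<alpha> \<beta> * jet_coordinate \<beta> j z h)"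
  proof (rule sum.cong[OF refl])
    fix \<beta> assume \<beta>: "\<beta> \<in> A"
    have "(\<Sum>l\<in>UNIV. jet_matrix d f z \<alpha> \<beta> * (if j = l then 1 else 0) * jet_restriction h z (\<beta>, l))
        = (\<Sum>l\<in>UNIV. if j = l then jet_matrix d f z \<alpha> \<beta> * jet_restriction h z (\<beta>, l) else 0)"
      by (rule sum.cong) auto
    then show "(\<Sum>l\<in>UNIV. jet_matrix d f z \<alpha> \<beta> * (if j = l then 1 else 0) * jet_restriction h z (\<beta>, l))
        = jet_matrix d f z \<alpha> \<beta> * jet_coordinate \<beta> j z h"
      using z \<beta> by (simp add: jet_restriction_apply)
  qed
  finally show "jet_restriction (act M f h) z (\<alpha>, j)
      = (\<lambda>z\<in>Z. jet_act d k f z (jet_restriction h z)) z (\<alpha>, j)"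
    using f h z \<alpha> by (simp add: jet_restriction_apply jet_coordinate_act zero_locus_subset)
qed (simp_all add: jet_act_def)

text \<open>The entry with index \<open>0\<close> of the jet is the function itself; \<open>1 \<le> k\<close> ensures that this entry
  is present.\<close>

lemma inj_on_jet_map: "inj_on (jet_map d k \<Omega>) (carrier M)"
proof (rule inj_onI)
  fix g h assume gh: "g \<in> carrier M" "h \<in> carrier M" and eq: "jet_map d k \<Omega> g = jet_map d k \<Omega> h"
  have 0: "(\<lambda>_. 0) \<in> A" using k by (simp add: jet_indices_def)
  have val: "jet_map d k \<Omega> h z (\<lambda>_. 0, j) = h z $ j" if "z \<in> \<Omega>" for h :: "'m cvec \<Rightarrow> complex ^ 'r" and z j
    using that 0 by (simp add: jet_map_def multi_partial_eq iterated_partial_zero_index)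
  show "g = h"
  proof (rule extensionalityI[OF extensional_M[OF gh(1)] extensional_M[OF gh(2)]])
    fix z assume "z \<in> \<Omega>"
    then show "g z = h z"
      using val[of z g] val[of z h] eq by (simp add: vec_eq_iff)
  qed
qed

lemma hnorm_JM: "h \<in> carrier M \<Longrightarrow> hnorm JM (jet_map d k \<Omega> h) = hnorm M h"
  by (simp add: hnorm_def jet_module_def jet_function_module_def the_inv_into_f_f[OF inj_on_jet_map])

lemma carrier_JM: "carrier JM = jet_map d k \<Omega> ` carrier M"
  by (simp add: jet_module_def jet_function_module_def)

text \<open>The functions with the same restricted jet as \<open>x\<close> form the coset \<open>x + M0\<close>.  As \<open>x\<close> is
  orthogonal to \<open>M0\<close>, it is the shortest element of this coset.\<close>

lemma restricted_norm_jet_restriction: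
  assumes x: "x \<in> Q"
  shows "restricted_norm JM Z (jet_restriction x) = hnorm M x"
  unfolding restricted_norm_def
proof (rule cInf_eq_minimum)
  have xM: "x \<in> carrier M" by (rule Q_carrier[OF x])
  show "hnorm M x \<in> {hnorm JM u | u. u \<in> carrier JM \<and> restrict u Z = jet_restriction x}"
    using xM hnorm_JM[OF xM]
    by (auto simp: carrier_JM jet_restriction_def intro!: exI[of _ "jet_map d k \<Omega> x"])
  fix r assume "r \<in> {hnorm JM u | u. u \<in> carrier JM \<and> restrict u Z = jet_restriction x}"
  then obtain h where h: "h \<in> carrier M" "r = hnorm M h" "jet_restriction h = jet_restriction x"
    by (auto simp: carrier_JM hnorm_JM jet_restriction_def)
  have "x \<oplus> (h \<ominus> x) = h"
    by (rule ip_eqI) (simp_all add: h xM)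
  moreover have "h \<ominus> x \<in> M0"
    using h xM jet_restriction_eq_iff by blast
  ultimately show "hnorm M x \<le> r"
    using hnorm_add_orthogonal_ge[OF x, of "h \<ominus> x"] h by simp
qed

text \<open>Both inner products are obtained by polarization, and the norms entering it agree because
  the complement is a linear space.\<close>

lemma ip_JMZ:
  assumes x: "x \<in> Q" and y: "y \<in> Q"
  shows "ip JMZ (jet_restriction x) (jet_restriction y) = ip M x y"
proof -
  note xy = Q_carrier[OF x] Q_carrier[OF y]
  have "(\<lambda>z\<in>Z. \<lambda>\<xi>\<in>A \<times> UNIV. jet_restriction x z \<xi> + \<i> ^ n * jet_restriction y z \<xi>)
      = jet_restriction (x \<oplus> \<i> ^ n \<odot>\<^bsub>M\<^esub> y)" for n
    by (rule jet_function_eqI)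
      (use xy in \<open>auto simp: jet_restriction_apply jet_coordinate_linear zero_locus_subset\<close>)
  moreover have "restricted_norm JM Z (jet_restriction (x \<oplus> \<i> ^ n \<odot>\<^bsub>M\<^esub> y))
      = hnorm M (x \<oplus> \<i> ^ n \<odot>\<^bsub>M\<^esub> y)" for n
    by (intro restricted_norm_jet_restriction Q_add Q_smult x y)
  ultimately show ?thesis
    using polarization[OF xy]
    by (simp add: jet_module_restricted_def jet_function_module_def)
qed

lemma unitary_jet_restriction: "unitary_between (quotient_module M M0) JMZ jet_restriction"
  unfolding unitary_between_def
proof (intro conjI ballI allI)
  have "inj_on jet_restriction Q"
  proof (rule inj_onI)
    fix x y assume x: "x \<in> Q" and y: "y \<in> Q" and eq: "jet_restriction x = jet_restriction y"
    then have "x \<ominus> y \<in> M0"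
      using jet_restriction_eq_iff Q_carrier by blast
    then have "x \<ominus> y = \<zero>" using Q_minus[OF x y] by (rule Q_inter_S[rotated])
    then show "x = y" using x y by (simp add: minus_eq_zero_iff Q_carrier)
  qed
  moreover have "jet_restriction h \<in> jet_restriction ` Q" if "h \<in> carrier M" for h
    using that P_in_Q[OF that] minus_P_in_S[OF that] jet_restriction_eq_iff[of h "P h"]
    by (intro image_eqI[of _ _ "P h"]) simp_all
  then have "jet_restriction ` Q = carrier JMZ"
    using Q_carrier by (auto simp: JMZ_simps)
  ultimately show "bij_betw jet_restriction (carrier (quotient_module M M0)) (carrier JMZ)"
    by (simp add: bij_betw_def)
qed (simp_all add: Q_carrier jet_restriction_add jet_restriction_smult ip_JMZ)

text \<open>The function \<open>f x\<close> and its projection differ by an element of the kernel \<open>M0\<close> of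
  \<open>jet_restriction\<close>, so the intertwining relation on \<open>M\<close> descends to the quotient action.\<close>

theorem quotient_equivalent_jets: "hilbert_modules_equivalent \<Omega> (quotient_module M M0) JMZ"
proof -
  have act: "jet_restriction (act (quotient_module M M0) f x) = act JMZ f (jet_restriction x)"
    if f: "f \<in> algebra_A \<Omega>" and x: "x \<in> carrier (quotient_module M M0)" for f x
  proof -
    have x: "x \<in> carrier M" using x by (simp add: Q_carrier)
    have "act M f x \<ominus> P (act M f x) \<in> M0" by (rule minus_P_in_S) (simp add: f x)
    then have "jet_restriction (P (act M f x)) = jet_restriction (act M f x)"
      using jet_restriction_eq_iff[of "act M f x" "P (act M f x)"] f x by simp
    then show ?thesis using jet_restriction_act[OF f x] by simp
  qed
  have "hilbert_module \<Omega> JMZ"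
    using hilbert_module_quotient unitary_jet_restriction
    by (rule hilbert_module_transport) (simp_all add: jet_restriction_zero act[simplified])
  then show ?thesis
    unfolding hilbert_modules_equivalent_def
    using hilbert_module_quotient unitary_jet_restriction act by blast
qed

end

theorem theorem4p5:
  fixes \<Omega> :: "'m::{finite,linorder} cvec set"
    and M :: "('m cvec \<Rightarrow> complex, 'm cvec \<Rightarrow> complex ^ 'r) hilb"
    and d k :: nat
  assumes "open \<Omega>" and "connected \<Omega>" and "bounded \<Omega>" and "0 \<in> \<Omega>"
    and "1 \<le> d" and "d \<le> CARD('m)" and "1 \<le> k"
    and "rk_hilbert_module \<Omega> M"
  shows "hilbert_modules_equivalent \<Omega>
           (quotient_module M (vanishing_submodule d k \<Omega> M))
           (jet_module_restricted d k \<Omega> M)"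
proof -
  interpret jet_quotient \<Omega> M d k
    using assms by unfold_locales
  show ?thesis by (rule quotient_equivalent_jets)
qed

end
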